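(* Let $R$ be a prime ring, $A$ an integrally closed subring of the center of $R$ whose fraction field $F$ has characteristic $0$, with $R$ a finitely generated $A$-module, and let $n=[R:A]$. If $\tau:R\to A$ is any trace (with values in $A$) for which $R$ is an $m$-Cayley–Hamilton algebra, then there is a positive integer $r$ such that $m=rn$ and $\tau=r\,t_{R/A}$.
   Context: $S=R\otimes_AF\cong M_k(D)$, $D$ a division ring with center $Z$, $\dim_ZD=h^2$, $p=[Z:F]$; $[R:A]:=hkp$; the reduced trace $t_{R/A}$ is the restriction to $R$ of $t_{S/F}(a)=\frac{1}{hk}\operatorname{tr}_F(L_a)$, $L_a$ left multiplication by $a$ on $S$ (it takes values in $A$). A trace on $R$ with values in $A$ is an $A$-linear map $\tau:R\to A$ with $\tau(ab)=\tau(ba)$ (and $\tau(\tau(a)b)=\tau(a)\tau(b)$). $R$ is $m$-Cayley–Hamilton for $\tau$ if $\tau(1)=m$ and $\chi^m_a(a)=0$ for all $a$, where $\chi^m_a(x)=x^m+\sum_{i=1}^mP_i(\tau(a),\dots,\tau(a^i))x^{m-i}$ with $P_i$ the universal rational polynomials expressing elementary symmetric functions via power sums. *)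

theory Defs
  imports "HOL-Computational_Algebra.Polynomial"
begin

definition ring_center :: "'r::ring_1 set" where
  "ring_center = {z. \<forall>x. z * x = x * z}"

text \<open>Prime ring: aRb = 0 implies a = 0 or b = 0 (R nonzero by class ring_1).\<close>
definition prime_ring :: "'r::ring_1 itself \<Rightarrow> bool" where
  "prime_ring _ \<longleftrightarrow> (\<forall>a b::'r. (\<forall>x. a * x * b = 0) \<longrightarrow> a = 0 \<or> b = 0)"

definition is_subring :: "'r::ring_1 set \<Rightarrow> bool" where
  "is_subring A \<longleftrightarrow> 0 \<in> A \<and> 1 \<in> A \<and>
     (\<forall>x\<in>A. \<forall>y\<in>A. x + y \<in> A \<and> x - y \<in> A \<and> x * y \<in> A)"

definition fin_gen_module :: "'r::ring_1 set \<Rightarrow> bool" where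
  "fin_gen_module A \<longleftrightarrow> (\<exists>G. finite G \<and>
     (\<forall>r::'r. \<exists>c. (\<forall>g\<in>G. c g \<in> A) \<and> r = (\<Sum>g\<in>G. c g * g)))"

definition is_trace :: "'r::ring_1 set \<Rightarrow> ('r \<Rightarrow> 'r) \<Rightarrow> bool" where
  "is_trace A \<tau> \<longleftrightarrow> (\<forall>x. \<tau> x \<in> A) \<and>
     (\<forall>x y. \<tau> (x + y) = \<tau> x + \<tau> y) \<and>
     (\<forall>a\<in>A. \<forall>x. \<tau> (a * x) = a * \<tau> x) \<and>
     (\<forall>x y. \<tau> (x * y) = \<tau> (y * x)) \<and>
     (\<forall>x y. \<tau> (\<tau> x * y) = \<tau> x * \<tau> y)"

text \<open>Data: F a field (type 'f), S a ring (type 'v), \<phi> : F \<rightarrow> S a ring homomorphism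
  into the centre of S, \<iota> : R \<rightarrow> S an injective ring homomorphism, and j : A \<rightarrow> F with
  \<phi> (j a) = \<iota> a.  We require F to be the fraction field of A (via j) and
  S = \<phi>(F) \<iota>(R).  Since R is A-torsion-free (R prime, A central), these conditions
  say exactly that S is R \<otimes>_A F with its canonical maps.\<close>
definition scalar_extension ::
  "'r::ring_1 set \<Rightarrow> ('r \<Rightarrow> 'f::field) \<Rightarrow> ('f \<Rightarrow> 'v::ring_1) \<Rightarrow> ('r \<Rightarrow> 'v) \<Rightarrow> bool" where
  "scalar_extension A j \<phi> \<iota> \<longleftrightarrow>
     \<phi> 1 = 1 \<and> (\<forall>x y. \<phi> (x + y) = \<phi> x + \<phi> y) \<and> (\<forall>x y. \<phi> (x * y) = \<phi> x * \<phi> y) \<and>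
     (\<forall>c s. \<phi> c * s = s * \<phi> c) \<and>
     \<iota> 1 = 1 \<and> (\<forall>x y. \<iota> (x + y) = \<iota> x + \<iota> y) \<and> (\<forall>x y. \<iota> (x * y) = \<iota> x * \<iota> y) \<and>
     inj \<iota> \<and>
     (\<forall>a\<in>A. \<phi> (j a) = \<iota> a) \<and>
     (\<forall>x. \<exists>a\<in>A. \<exists>b\<in>A. b \<noteq> 0 \<and> x = j a / j b) \<and>
     (\<forall>s. \<exists>c r. s = \<phi> c * \<iota> r)"

definition integrally_closed :: "'r::ring_1 set \<Rightarrow> ('r \<Rightarrow> 'f::field) \<Rightarrow> bool" where
  "integrally_closed A j \<longleftrightarrow>
     (\<forall>x::'f. (\<exists>p. lead_coeff p = 1 \<and> (\<forall>i. coeff p i \<in> j ` A) \<and> poly p x = 0) \<longrightarrow> x \<in> j ` A)"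

definition fscale :: "('f::field \<Rightarrow> 'v::ring_1) \<Rightarrow> 'f \<Rightarrow> 'v \<Rightarrow> 'v" where
  "fscale \<phi> c s = \<phi> c * s"

definition lin_trace :: "('f::field \<Rightarrow> 'v::ring_1) \<Rightarrow> ('v \<Rightarrow> 'v) \<Rightarrow> 'f" where
  "lin_trace \<phi> L =
    (let B = (SOME B. finite B \<and> \<not> module.dependent (fscale \<phi>) B \<and>
                       module.span (fscale \<phi>) B = UNIV)
     in \<Sum>b\<in>B. module.representation (fscale \<phi>) B (L b) b)"

definition center_deg :: "('f::field \<Rightarrow> 'v::ring_1) \<Rightarrow> nat" where
  "center_deg \<phi> = vector_space.dim (fscale \<phi>) (ring_center :: 'v set)"

text \<open>hk, where S \<cong> M_k(D), dim_Z D = h^2: the number d with d^2 = dim_Z S,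
  i.e. d^2 * p = dim_F S.\<close>
definition red_deg :: "('f::field \<Rightarrow> 'v::ring_1) \<Rightarrow> nat" where
  "red_deg \<phi> = (THE d. d^2 * center_deg \<phi> = vector_space.dim (fscale \<phi>) (UNIV :: 'v set))"

definition ring_index :: "('f::field \<Rightarrow> 'v::ring_1) \<Rightarrow> nat" where
  "ring_index \<phi> = red_deg \<phi> * center_deg \<phi>"

definition reduced_trace :: "('f::field \<Rightarrow> 'v::ring_1) \<Rightarrow> ('r \<Rightarrow> 'v) \<Rightarrow> 'r \<Rightarrow> 'f" where
  "reduced_trace \<phi> \<iota> x = lin_trace \<phi> (\<lambda>s. \<iota> x * s) / of_nat (red_deg \<phi>)"

text \<open>Elementary symmetric functions from power sums via Newton's identities:
  i e_i = sum_{j=1}^{i} (-1)^(j-1) e_{i-j} p_j.\<close>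
function newton_e :: "(nat \<Rightarrow> 'f::field) \<Rightarrow> nat \<Rightarrow> 'f" where
  "newton_e ps 0 = 1"
| "newton_e ps (Suc i) =
     (\<Sum>k\<in>{1..Suc i}. (-1)^(k-1) * newton_e ps (Suc i - k) * ps k) / of_nat (Suc i)"
  by pat_completeness auto
termination by (relation "measure snd") auto

text \<open>P_i(tau(a),...,tau(a^i)) = (-1)^i e_i, so
  chi_a(x) = x^m + sum_{i=1}^m (-1)^i e_i x^(m-i); evaluated at a inside S.\<close>
definition cayley_hamilton :: "'r::ring_1 set \<Rightarrow> ('r \<Rightarrow> 'f::field) \<Rightarrow> ('f \<Rightarrow> 'v::ring_1) \<Rightarrow>
    ('r \<Rightarrow> 'v) \<Rightarrow> ('r \<Rightarrow> 'r) \<Rightarrow> nat \<Rightarrow> bool" where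
  "cayley_hamilton A j \<phi> \<iota> \<tau> m \<longleftrightarrow> \<tau> 1 = of_nat m \<and>
     (\<forall>a. \<iota> a ^ m +
        (\<Sum>i\<in>{1..m}. \<phi> ((-1)^i * newton_e (\<lambda>k. j (\<tau> (a ^ k))) i) * \<iota> a ^ (m - i)) = 0)"

end

theory Submission
  imports Defs "Jordan_Normal_Form.Determinant" "HOL-Computational_Algebra.Polynomial_FPS"
begin

text \<open>
  Let \<open>T\<close> be the trace of left multiplication on \<open>S\<close> and \<open>t\<close> the extension of \<open>\<tau>\<close> to \<open>S\<close>; no splitting
  field is needed. The form \<open>T (x y)\<close> is nondegenerate, since a nonzero right ideal of a prime
  finite-dimensional algebra contains a nonzero idempotent, so a symmetric functional has the form
  \<open>T (c x)\<close> with \<open>c\<close> central. On a subfield \<open>F[x]\<close> the Cayley-Hamilton identity forces the reversed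
  characteristic polynomial of \<open>x\<close> to be a power of the reversed minimal polynomial; hence \<open>t\<close>
  is an integral multiple of the field trace there. Applied to the centre this gives
  \<open>t = (m / dim S) T\<close>. Applied to a maximal subfield \<open>E = F[y]\<close> of the division algebra \<open>e S e\<close>, for a
  primitive idempotent \<open>e\<close>, it gives \<open>t e = b [E:F]\<close> with an integer \<open>b\<close>, which turns out to be \<open>r\<close>.
  With \<open>n = dim (e S) / dim E\<close>, computing in two ways the trace of the projection of \<open>S\<close> onto \<open>E\<close>
  built from dual bases of \<open>E\<close> shows \<open>dim S = n^2 dim Z\<close>, so that \<open>n\<close> is the reduced degree.
\<close>

subsection \<open>Traces on subspaces of an algebra\<close>

text \<open>Proportionality to \<open>T\<close> is not enough: with \<open>N = dim S = n^2 p\<close>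
  and \<open>p = dim Z\<close> it makes \<open>t\<close> only the rational multiple
  \<open>m / (n p)\<close> of the reduced trace \<open>T / n\<close>. Integrality has to come from
  an element of small trace. A primitive idempotent \<open>e\<close> has \<open>T e = n q\<close>
  with \<open>q = [E:F]\<close>, so \<open>t e = (m / N) n q = m q / (n p)\<close>. Against
  \<open>t e = b q\<close> this is \<open>m = b n p\<close>. The subfield must be maximal: a smaller
  one gives only a multiple of its own smaller degree. The reversed polynomials are handled through
  inverses: up to a scalar, the minimal polynomial of \<open>w = 1/x\<close> is the reversed minimal
  polynomial of \<open>x\<close>. Hence the field lemmas speak about \<open>x\<close> in terms of a
  polynomial \<open>g\<close> annihilating its inverse. Characteristic 0 enters four times:
  dimensions can be read off traces, an idempotent of trace 0 vanishes, Newton's identities can be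
  solved, and \<open>g\<close> does not divide its derivative. The relation
  \<open>dim S = n^2 dim Z\<close> usually rests on Wedderburn's theorem or on double centralizers.
  Here it comes from the trace of two-sided multiplications \<open>s -> a s b\<close>, so neither
  matrices over a division ring nor a change of base field appear.\<close>

locale central_algebra =
  fixes \<phi> :: "'f::field_char_0 \<Rightarrow> 'v::ring_1"
  assumes phi_1 [simp]: "\<phi> 1 = 1"
    and phi_add: "\<phi> (x + y) = \<phi> x + \<phi> y"
    and phi_mult: "\<phi> (x * y) = \<phi> x * \<phi> y"
    and phi_central: "\<phi> c * s = s * \<phi> c"
begin

sublocale vector_space "fscale \<phi>"
  by unfold_locales (auto simp: fscale_def algebra_simps phi_add phi_mult)

lemma phi_0 [simp]: "\<phi> 0 = 0"
  using phi_add[of 0 0] by simp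

lemma phi_minus: "\<phi> (- x) = - \<phi> x"
  using phi_add[of x "- x"] by (simp add: eq_neg_iff_add_eq_0 add.commute)

lemma phi_diff: "\<phi> (x - y) = \<phi> x - \<phi> y"
  using phi_add[of x "- y"] by (simp add: phi_minus)

lemma phi_of_nat: "\<phi> (of_nat n) = of_nat n"
  by (induction n) (auto simp: phi_add)

lemma phi_mult_eq_0_iff [simp]: "\<phi> c * x = 0 \<longleftrightarrow> c = 0 \<or> x = 0"
  using scale_eq_0_iff[of c x] by (simp add: fscale_def)

lemma phi_eq_0_iff [simp]: "\<phi> c = 0 \<longleftrightarrow> c = 0"
  using phi_mult_eq_0_iff[of c 1] by simp

lemma phi_inverse: "c \<noteq> 0 \<Longrightarrow> \<phi> (inverse c) * (\<phi> c * x) = x"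
  by (simp flip: mult.assoc phi_mult)

lemma phi_left_commute: "x * (\<phi> c * y) = \<phi> c * (x * y)"
  by (metis mult.assoc phi_central)

text \<open>Linearity is asked only on \<open>V\<close>: the coordinate functions of a basis of
  \<open>V\<close> are zero off its span and hence not linear on the whole algebra.\<close>

definition functional_on :: "'v set \<Rightarrow> ('v \<Rightarrow> 'f) \<Rightarrow> bool" where
  "functional_on V f \<longleftrightarrow> (\<forall>x\<in>V. \<forall>y\<in>V. f (x + y) = f x + f y) \<and> (\<forall>c. \<forall>x\<in>V. f (\<phi> c * x) = c * f x)"

definition endo :: "('v \<Rightarrow> 'v) \<Rightarrow> bool" where
  "endo L \<longleftrightarrow> (\<forall>x y. L (x + y) = L x + L y) \<and> (\<forall>c x. L (\<phi> c * x) = \<phi> c * L x)"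

text \<open>A family with an arbitrary index type, so that exponents of a generator or a disjoint
  sum of two bases can serve as indices.\<close>

definition frame :: "'v set \<Rightarrow> 'i set \<Rightarrow> ('i \<Rightarrow> 'v) \<Rightarrow> ('i \<Rightarrow> 'v \<Rightarrow> 'f) \<Rightarrow> bool" where
  "frame V I v f \<longleftrightarrow> finite I \<and> (\<forall>i\<in>I. v i \<in> V \<and> functional_on V (f i)) \<and>
     (\<forall>x\<in>V. x = (\<Sum>i\<in>I. \<phi> (f i x) * v i))"

text \<open>The vectors of a frame need not be independent: the sum below is still the trace.\<close>
definition trace_on :: "'v set \<Rightarrow> ('v \<Rightarrow> 'v) \<Rightarrow> 'f" where
  "trace_on V L = (case SOME (B, f). frame V B (\<lambda>b. b) f of (B, f) \<Rightarrow> \<Sum>b\<in>B. f b (L b))"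

lemma subspace_phi: "subspace V \<Longrightarrow> x \<in> V \<Longrightarrow> \<phi> c * x \<in> V"
  using subspace_scale[of V x c] by (simp add: fscale_def)

lemma subspaceI': "0 \<in> V \<Longrightarrow> (\<And>x y. x \<in> V \<Longrightarrow> y \<in> V \<Longrightarrow> x + y \<in> V) \<Longrightarrow>
    (\<And>c x. x \<in> V \<Longrightarrow> \<phi> c * x \<in> V) \<Longrightarrow> subspace V"
  by (simp add: subspace_def fscale_def)

lemma linear_iff_endo: "Vector_Spaces.linear (fscale \<phi>) (fscale \<phi>) L \<longleftrightarrow> endo L"
  by (auto simp: Vector_Spaces.linear_iff endo_def fscale_def vector_space_axioms)

lemma functional_on_add: "functional_on V f \<Longrightarrow> x \<in> V \<Longrightarrow> y \<in> V \<Longrightarrow> f (x + y) = f x + f y"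
  and functional_on_scale: "functional_on V f \<Longrightarrow> x \<in> V \<Longrightarrow> f (\<phi> c * x) = c * f x"
  by (auto simp: functional_on_def)

lemma functional_on_0: "functional_on V f \<Longrightarrow> 0 \<in> V \<Longrightarrow> f 0 = 0"
  using functional_on_scale[of V f 0 0] by simp

lemma functional_on_sum:
  assumes "functional_on V f" "subspace V" "\<And>i. i \<in> I \<Longrightarrow> v i \<in> V"
  shows "f (\<Sum>i\<in>I. v i) = (\<Sum>i\<in>I. f (v i))"
  using assms(3)
proof (induction I rule: infinite_finite_induct)
  case (insert i I)
  then show ?case
    using assms subspace_sum[of V I v] by (simp add: functional_on_add)
qed (use assms in \<open>auto simp: functional_on_0 subspace_0\<close>)

lemma functional_on_lincomb:
  assumes "functional_on V f" "subspace V" "\<And>i. i \<in> I \<Longrightarrow> v i \<in> V"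
  shows "f (\<Sum>i\<in>I. \<phi> (c i) * v i) = (\<Sum>i\<in>I. c i * f (v i))"
  using functional_on_sum[OF assms(1,2), of I "\<lambda>i. \<phi> (c i) * v i"] assms
  by (simp add: subspace_phi functional_on_scale)

lemma functional_on_minus: "functional_on V f \<Longrightarrow> subspace V \<Longrightarrow> x \<in> V \<Longrightarrow> f (- x) = - f x"
  using functional_on_scale[of V f x "-1"] by (simp add: phi_minus)

lemma functional_on_diff:
  "functional_on V f \<Longrightarrow> subspace V \<Longrightarrow> x \<in> V \<Longrightarrow> y \<in> V \<Longrightarrow> f (x - y) = f x - f y"
  using functional_on_add[of V f x "- y"] by (simp add: functional_on_minus subspace_neg)

lemma frame_finite: "frame V I v f \<Longrightarrow> finite I"
  and frame_in: "frame V I v f \<Longrightarrow> i \<in> I \<Longrightarrow> v i \<in> V"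
  and frame_functional: "frame V I v f \<Longrightarrow> i \<in> I \<Longrightarrow> functional_on V (f i)"
  and frame_expand: "frame V I v f \<Longrightarrow> x \<in> V \<Longrightarrow> x = (\<Sum>i\<in>I. \<phi> (f i x) * v i)"
  unfolding frame_def by blast+

lemma endo_add: "endo L \<Longrightarrow> L (x + y) = L x + L y"
  and endo_scale: "endo L \<Longrightarrow> L (\<phi> c * x) = \<phi> c * L x"
  by (auto simp: endo_def)

lemma endo_0: "endo L \<Longrightarrow> L 0 = 0"
  using endo_add[of L 0 0] by simp

lemma endo_diff: "endo L \<Longrightarrow> L (x - y) = L x - L y"
  by (metis add_diff_cancel diff_add_cancel endo_add)

lemma endo_sum: "endo L \<Longrightarrow> L (\<Sum>i\<in>I. v i) = (\<Sum>i\<in>I. L (v i))"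
  by (induction I rule: infinite_finite_induct) (auto simp: endo_0 endo_add)

lemma endo_lmult: "endo (\<lambda>s. a * s)"
  by (simp add: endo_def algebra_simps phi_left_commute)

lemma endo_rmult: "endo (\<lambda>s. s * b)"
  by (simp add: endo_def algebra_simps)

lemma endo_comp: "endo L \<Longrightarrow> endo M \<Longrightarrow> endo (\<lambda>s. L (M s))"
  by (simp add: endo_def)

lemma endo_lrmult: "endo (\<lambda>s. a * s * b)"
  by (simp add: endo_def algebra_simps phi_left_commute)

lemma endo_id: "endo (\<lambda>s. s)"
  by (simp add: endo_def)

lemma endo_lincomb: "(\<And>i. i \<in> I \<Longrightarrow> endo (L i)) \<Longrightarrow> endo (\<lambda>s. \<Sum>i\<in>I. L i s)"
  by (auto simp: endo_def sum.distrib sum_distrib_left)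

lemma endo_expand:
  assumes "frame V I v f" "endo L" "x \<in> V"
  shows "L x = (\<Sum>i\<in>I. \<phi> (f i x) * L (v i))"
  by (rule trans[OF arg_cong[OF frame_expand[OF assms(1,3)], of L]])
    (simp add: endo_sum endo_scale assms(2))

lemma functional_expand:
  assumes "frame V I v f" "functional_on W g" "subspace W" "V \<subseteq> W" "x \<in> V"
  shows "g x = (\<Sum>i\<in>I. f i x * g (v i))"
  by (rule trans[OF arg_cong[OF frame_expand[OF assms(1,5)], of g]])
    (use assms(4) in \<open>auto intro!: functional_on_lincomb[OF assms(2,3)] dest: frame_in[OF assms(1)]\<close>)

text \<open>Independence of the frame and, for \<open>V \<subset> W\<close>, restriction of the trace to a subspace
  containing the image.\<close>
lemma frame_trace_eq:
  assumes W: "frame W I v f" "subspace W" and V: "frame V J w g" "subspace V" and "V \<subseteq> W"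
    and L: "endo L" "\<And>x. x \<in> W \<Longrightarrow> L x \<in> V"
  shows "(\<Sum>i\<in>I. f i (L (v i))) = (\<Sum>j\<in>J. g j (L (w j)))"
proof -
  have "(\<Sum>i\<in>I. f i (L (v i))) = (\<Sum>i\<in>I. \<Sum>j\<in>J. g j (L (v i)) * f i (w j))"
    using \<open>V \<subseteq> W\<close> L(2) frame_in[OF W(1)]
    by (intro sum.cong refl functional_expand[OF V(1) _ W(2)] frame_functional[OF W(1)]) auto
  also have "\<dots> = (\<Sum>j\<in>J. \<Sum>i\<in>I. f i (w j) * g j (L (v i)))"
    by (subst sum.swap) (simp add: mult.commute)
  also have "\<dots> = (\<Sum>j\<in>J. g j (\<Sum>i\<in>I. \<phi> (f i (w j)) * L (v i)))"
    using L frame_in[OF W(1)]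
    by (intro sum.cong refl functional_on_lincomb[of V, symmetric] frame_functional[OF V(1)] V(2)) auto
  also have "\<dots> = (\<Sum>j\<in>J. g j (L (w j)))"
    using \<open>V \<subseteq> W\<close> frame_in[OF V(1)]
    by (intro sum.cong refl arg_cong[of _ _ "g _"] endo_expand[OF W(1) L(1), symmetric]) auto
  finally show ?thesis .
qed

lemma frame_basis:
  assumes "finite B" "independent B" "span B = V"
  shows "frame V B (\<lambda>b. b) (\<lambda>b x. representation B x b)"
  unfolding frame_def functional_on_def
  using assms(1,3) representation_add[OF assms(2)] representation_scale[OF assms(2)]
    sum_representation_eq[OF assms(2) _ assms(1) order_refl, symmetric] span_base[of _ B]
  by (auto simp only: fscale_def)

end

section \<open>Finite dimension: properties of the trace, and representation of functionals\<close>

locale fd_central_algebra = central_algebra \<phi> for \<phi> :: "'f::field_char_0 \<Rightarrow> 'v::ring_1" +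
  fixes Basis :: "'v set"
  assumes fin_Basis: "finite Basis"
    and indep_Basis: "independent Basis"
    and span_Basis': "span Basis = UNIV"
begin

sublocale finite_dimensional_vector_space "fscale \<phi>" Basis
  by unfold_locales (use fin_Basis indep_Basis span_Basis' in auto)

lemma obtain_basis:
  assumes "subspace V"
  obtains B where "finite B" "independent B" "span B = V" "card B = dim V" "B \<subseteq> V"
  using basis_subspace_exists[OF assms] finiteI_independent by metis

lemma trace_on_frame:
  assumes "subspace V" "frame V I v f" "endo L" "\<And>x. x \<in> V \<Longrightarrow> L x \<in> V"
  shows "trace_on V L = (\<Sum>i\<in>I. f i (L (v i)))"
proof -
  obtain B where "finite B" "independent B" "span B = V"
    using obtain_basis[OF assms(1)] by metis
  then have "\<exists>p. case p of (B, f) \<Rightarrow> frame V B (\<lambda>b. b) f"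
    using frame_basis by auto
  then have "case SOME (B, f). frame V B (\<lambda>b. b) f of (B, f) \<Rightarrow> frame V B (\<lambda>b. b) f"
    by (rule someI_ex)
  then obtain B f' where B: "(SOME (B, f). frame V B (\<lambda>b. b) f) = (B, f')" "frame V B (\<lambda>b. b) f'"
    by (auto split: prod.splits)
  then show ?thesis
    using frame_trace_eq[OF B(2) assms(1) assms(2,1)] assms(3,4)
    by (simp add: trace_on_def)
qed

lemma obtain_frame:
  assumes "subspace V"
  obtains B :: "'v set" and f where "frame V B (\<lambda>b. b) f"
proof -
  obtain B where "finite B" "independent B" "span B = V"
    using obtain_basis[OF assms] by metis
  note fr = frame_basis[OF this]
  show ?thesis by (rule that[OF fr])
qed

lemma obtain_dual_frame:
  assumes "subspace V"
  obtains B :: "'v set" and f where "frame V B (\<lambda>b. b) f" "card B = dim V"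
    "\<forall>b\<in>B. \<forall>b'\<in>B. f b b' = (if b = b' then 1 else 0)"
proof -
  obtain B where B: "finite B" "independent B" "span B = V" "card B = dim V"
    using obtain_basis[OF assms] by metis
  show ?thesis
    by (rule that[OF frame_basis[OF B(1-3)] B(4)]) (auto simp: representation_basis B(2))
qed

lemma trace_on_image:
  assumes "subspace V" "subspace W" "V \<subseteq> W" "endo L" "\<And>x. x \<in> W \<Longrightarrow> L x \<in> V"
  shows "trace_on W L = trace_on V L"
proof -
  obtain B f where B: "frame V B (\<lambda>b. b) f"
    by (rule obtain_frame[OF assms(1)])
  note B = B trace_on_frame[OF assms(1) B]
  obtain C g where C: "frame W C (\<lambda>b. b) g"
    by (rule obtain_frame[OF assms(2)])
  note C = C trace_on_frame[OF assms(2) C]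
  have "trace_on V L = (\<Sum>b\<in>B. f b (L b))" "trace_on W L = (\<Sum>b\<in>C. g b (L b))"
    using assms by (auto intro!: B(2) C(2))
  then show ?thesis
    using frame_trace_eq[OF C(1) assms(2) B(1) assms(1,3-)] by simp
qed

lemma trace_on_cong:
  assumes "subspace V" "endo L" "endo M" "\<And>x. x \<in> V \<Longrightarrow> L x \<in> V" "\<And>x. x \<in> V \<Longrightarrow> L x = M x"
  shows "trace_on V L = trace_on V M"
proof -
  obtain B f where B: "frame V B (\<lambda>b. b) f"
    by (rule obtain_frame[OF assms(1)])
  note B = B trace_on_frame[OF assms(1) B]
  have "trace_on V L = (\<Sum>b\<in>B. f b (L b))" using assms by (intro B(2)) auto
  moreover have "trace_on V M = (\<Sum>b\<in>B. f b (M b))" using assms by (intro B(2)) auto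
  ultimately show ?thesis using frame_in[OF B(1)] assms by simp
qed

lemma trace_on_scale:
  assumes "subspace V" "endo L" "\<And>x. x \<in> V \<Longrightarrow> L x \<in> V"
  shows "trace_on V (\<lambda>s. \<phi> c * L s) = c * trace_on V L"
proof -
  obtain B f where B: "frame V B (\<lambda>b. b) f"
    by (rule obtain_frame[OF assms(1)])
  note B = B trace_on_frame[OF assms(1) B]
  have "trace_on V (\<lambda>s. \<phi> c * L s) = (\<Sum>b\<in>B. f b (\<phi> c * L b))"
    using assms by (intro B(2) endo_comp[OF endo_lmult assms(2)]) (auto intro: subspace_phi)
  also have "\<dots> = (\<Sum>b\<in>B. c * f b (L b))"
    using assms frame_in[OF B(1)]
    by (intro sum.cong refl functional_on_scale[OF frame_functional[OF B(1)]]) auto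
  also have "\<dots> = c * trace_on V L"
    using B(2) assms by (simp add: sum_distrib_left)
  finally show ?thesis .
qed

lemma trace_on_sum:
  assumes "subspace V" "\<And>i. i \<in> I \<Longrightarrow> endo (L i)" "\<And>i x. i \<in> I \<Longrightarrow> x \<in> V \<Longrightarrow> L i x \<in> V"
  shows "trace_on V (\<lambda>s. \<Sum>i\<in>I. L i s) = (\<Sum>i\<in>I. trace_on V (L i))"
proof -
  obtain B f where B: "frame V B (\<lambda>b. b) f"
    by (rule obtain_frame[OF assms(1)])
  note B = B trace_on_frame[OF assms(1) B]
  have "trace_on V (\<lambda>s. \<Sum>i\<in>I. L i s) = (\<Sum>b\<in>B. f b (\<Sum>i\<in>I. L i b))"
    using assms by (intro B(2) endo_lincomb) (auto intro: subspace_sum)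
  also have "\<dots> = (\<Sum>b\<in>B. \<Sum>i\<in>I. f b (L i b))"
    using assms frame_in[OF B(1)]
    by (intro sum.cong refl functional_on_sum[of V] frame_functional[OF B(1)]) auto
  also have "\<dots> = (\<Sum>i\<in>I. \<Sum>b\<in>B. f b (L i b))"
    by (rule sum.swap)
  also have "\<dots> = (\<Sum>i\<in>I. trace_on V (L i))"
    using B(2) assms by (intro sum.cong) auto
  finally show ?thesis .
qed

lemma trace_on_add:
  assumes "subspace V" "endo L" "endo M" "\<And>x. x \<in> V \<Longrightarrow> L x \<in> V" "\<And>x. x \<in> V \<Longrightarrow> M x \<in> V"
  shows "trace_on V (\<lambda>s. L s + M s) = trace_on V L + trace_on V M"
  using trace_on_sum[OF assms(1), of "{False, True}" "\<lambda>i. if i then L else M"] assms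
  by (auto simp: add.commute)

lemma trace_on_id:
  assumes "subspace V"
  shows "trace_on V (\<lambda>s. s) = of_nat (dim V)"
proof -
  obtain B f where B: "frame V B (\<lambda>b. b) f" "card B = dim V"
    "\<forall>b\<in>B. \<forall>b'\<in>B. f b b' = (if b = b' then 1 else 0)"
    by (rule obtain_dual_frame[OF assms])
  have "trace_on V (\<lambda>s. s) = (\<Sum>b\<in>B. f b b)"
    by (rule trace_on_frame[OF assms B(1) endo_id])
  also have "\<dots> = of_nat (card B)" using B(3) by simp
  finally show ?thesis using B(2) by simp
qed

lemma trace_cyclic:
  assumes "endo L" "endo M"
  shows "trace_on UNIV (\<lambda>s. L (M s)) = trace_on UNIV (\<lambda>s. M (L s))"
proof -
  obtain B f where B: "frame UNIV B (\<lambda>b. b) f"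
    by (rule obtain_frame[OF subspace_UNIV])
  note B = B trace_on_frame[OF subspace_UNIV B]
  have *: "f b (L (M b)) = (\<Sum>c\<in>B. f c (M b) * f b (L c))"
    if "b \<in> B" "endo L" for b L M
  proof -
    have "L (M b) = (\<Sum>c\<in>B. \<phi> (f c (M b)) * L c)"
      by (rule endo_expand[OF B(1) \<open>endo L\<close>]) simp
    then show ?thesis
      using functional_on_lincomb[OF frame_functional[OF B(1) \<open>b \<in> B\<close>], of B L] by simp
  qed
  have "(\<Sum>b\<in>B. f b (L (M b))) = (\<Sum>b\<in>B. f b (M (L b)))"
    using assms by (simp add: *) (subst sum.swap, simp add: mult.commute)
  then show ?thesis
    using B(2) assms by (simp add: endo_comp)
qed

lemma lin_trace_eq: "endo L \<Longrightarrow> lin_trace \<phi> L = trace_on UNIV L"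
proof -
  assume L: "endo L"
  define B where "B = (SOME B. finite B \<and> independent B \<and> span B = UNIV)"
  have "finite B \<and> independent B \<and> span B = UNIV"
    unfolding B_def by (rule someI[of _ Basis]) (use fin_Basis indep_Basis span_Basis' in auto)
  then have "frame UNIV B (\<lambda>b. b) (\<lambda>b x. representation B x b)"
    by (intro frame_basis) auto
  then show ?thesis
    using trace_on_frame[OF subspace_UNIV _ L, of B "\<lambda>b. b" "\<lambda>b x. representation B x b"]
    by (simp add: lin_trace_def Let_def flip: B_def)
qed

text \<open>Applied to left multiplications, this turns the absence of zero divisors into
  solvability of \<open>x * y = e\<close>.\<close>

lemma inj_endo_imp_surj:
  assumes "endo L" "subspace V" "\<And>x. x \<in> V \<Longrightarrow> L x \<in> V" "\<And>x. x \<in> V \<Longrightarrow> L x = 0 \<Longrightarrow> x = 0"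
  shows "L ` V = V"
proof (rule subspace_dim_equal)
  interpret P: finite_dimensional_vector_space_pair_1 "fscale \<phi>" Basis "fscale \<phi>"
    by unfold_locales
  have lin: "Vector_Spaces.linear (fscale \<phi>) (fscale \<phi>) L"
    using assms(1) linear_iff_endo by blast
  have "inj_on L V"
    by (rule inj_onI) (metis assms(1,2,4) endo_diff right_minus_eq subspace_diff)
  then have "dim (L ` V) = dim V"
    using P.dim_image_eq[OF lin, of V] assms(2) by (simp add: span_eq_iff[THEN iffD2])
  then show "dim V \<le> dim (L ` V)" by simp
  show "subspace (L ` V)"
    by (rule P.linear_subspace_image[OF lin assms(2)])
qed (use assms in auto)

lemma dim_image_eq:
  assumes "endo L" "subspace V" "\<And>x. x \<in> V \<Longrightarrow> L x = 0 \<Longrightarrow> x = 0"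
  shows "dim (L ` V) = dim V"
proof -
  interpret P: finite_dimensional_vector_space_pair_1 "fscale \<phi>" Basis "fscale \<phi>"
    by unfold_locales
  have lin: "Vector_Spaces.linear (fscale \<phi>) (fscale \<phi>) L"
    using assms(1) linear_iff_endo by blast
  have "inj_on L V"
    by (rule inj_onI) (metis assms(1,2,3) endo_diff right_minus_eq subspace_diff)
  then show ?thesis
    using P.dim_image_eq[OF lin, of V] assms(2) by (simp add: span_eq_iff[THEN iffD2])
qed

lemma subspace_endo_image: "endo L \<Longrightarrow> subspace V \<Longrightarrow> subspace (L ` V)"
proof -
  assume "endo L" "subspace V"
  interpret P: finite_dimensional_vector_space_pair_1 "fscale \<phi>" Basis "fscale \<phi>"
    by unfold_locales
  show ?thesis
    using P.linear_subspace_image[of L V] \<open>endo L\<close> \<open>subspace V\<close> linear_iff_endo by blast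
qed

text \<open>Sending \<open>a\<close> to the functional \<open>T (a * x)\<close> is injective by
  nondegeneracy. A basis identifies functionals with vectors of \<open>V\<close>, so this map
  becomes an injective endomorphism of \<open>V\<close> and is onto.\<close>

lemma riesz:
  assumes V: "subspace V" and T: "functional_on UNIV T"
    and nondeg: "\<And>a. a \<in> V \<Longrightarrow> (\<And>x. x \<in> V \<Longrightarrow> T (a * x) = 0) \<Longrightarrow> a = 0"
    and \<psi>: "functional_on V \<psi>"
  shows "\<exists>a\<in>V. \<forall>x\<in>V. T (a * x) = \<psi> x"
proof -
  obtain B f where fr: "frame V B (\<lambda>b. b) f" "card B = dim V"
    and dual: "\<forall>b\<in>B. \<forall>b'\<in>B. f b b' = (if b = b' then 1 else 0)"
    by (rule obtain_dual_frame[OF V])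
  then have B: "finite B" "B \<subseteq> V" using frame_finite frame_in by auto
  \<comment> \<open>The coordinates of \<open>L a\<close> are the values of \<open>T (a * _)\<close>
    on the basis.\<close>
  define L where "L a = (\<Sum>b\<in>B. \<phi> (T (a * b)) * b)" for a
  have L: "endo L"
    unfolding L_def endo_def
    by (auto simp: sum.distrib sum_distrib_left algebra_simps phi_add phi_mult
        functional_on_add[OF T] functional_on_scale[OF T])
  have coord: "f b (\<Sum>b'\<in>B. \<phi> (c b') * b') = c b" if "b \<in> B" for b c
  proof -
    have "f b (\<Sum>b'\<in>B. \<phi> (c b') * b') = (\<Sum>b'\<in>B. c b' * f b b')"
      using B V that by (intro functional_on_lincomb[of V] frame_functional[OF fr(1)]) auto
    also have "\<dots> = (\<Sum>b'\<in>B. if b' = b then c b else 0)"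
      using that by (intro sum.cong) (auto simp: dual)
    finally show ?thesis using that B by simp
  qed
  have ext: "T (a * x) = \<psi> x" if "\<And>b. b \<in> B \<Longrightarrow> T (a * b) = \<psi> b" "functional_on V \<psi>" "x \<in> V" for a x \<psi>
  proof -
    have Ta: "functional_on V (\<lambda>x. T (a * x))"
      by (auto simp: functional_on_def algebra_simps functional_on_add[OF T] functional_on_scale[OF T]
          phi_left_commute)
    show ?thesis
      using functional_expand[OF fr(1) Ta V order_refl that(3)]
        functional_expand[OF fr(1) that(2) V order_refl that(3)] that(1) by simp
  qed
  have "L ` V = V"
  proof (rule inj_endo_imp_surj[OF L V])
    show "L x \<in> V" for x
      unfolding L_def using B V by (intro subspace_sum) (auto intro: subspace_phi)
    show "a = 0" if a: "a \<in> V" "L a = 0" for a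
    proof (rule nondeg[OF a(1)])
      fix x assume "x \<in> V"
      have "T (a * b) = 0" if "b \<in> B" for b
        using coord[OF that, of "\<lambda>b. T (a * b)"] a(2) that V frame_functional[OF fr(1) that]
        by (simp add: L_def functional_on_0 subspace_0)
      then show "T (a * x) = 0"
        using ext[of a "\<lambda>_. 0" x] \<open>x \<in> V\<close> by (simp add: functional_on_def)
    qed
  qed
  moreover have "(\<Sum>b\<in>B. \<phi> (\<psi> b) * b) \<in> V"
    using B V by (intro subspace_sum) (auto intro: subspace_phi)
  ultimately have "(\<Sum>b\<in>B. \<phi> (\<psi> b) * b) \<in> L ` V" by simp
  then obtain a where a: "(\<Sum>b\<in>B. \<phi> (\<psi> b) * b) = L a" "a \<in> V" by (rule imageE)
  have "T (a * b) = \<psi> b" if "b \<in> B" for b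
  proof -
    have "T (a * b) = f b (L a)" unfolding L_def by (rule coord[OF that, symmetric])
    also have "\<dots> = \<psi> b" unfolding a(1)[symmetric] by (rule coord[OF that])
    finally show ?thesis .
  qed
  then have "T (a * x) = \<psi> x" if "x \<in> V" for x
    by (rule ext[OF _ \<psi> that])
  then show ?thesis using a(2) by blast
qed

end

subsection \<open>Domain subalgebras and the regular trace\<close>

context fd_central_algebra
begin

text \<open>The unit \<open>e\<close> may differ from \<open>1\<close> and commutativity is not
  asked, so the notion covers the centre, the corner \<open>e S e\<close> and subfields of that
  corner alike.\<close>

definition domain_subalgebra :: "'v set \<Rightarrow> 'v \<Rightarrow> bool" where
  "domain_subalgebra E e \<longleftrightarrow> subspace E \<and> e \<in> E \<and> e \<noteq> 0 \<and> (\<forall>x\<in>E. e * x = x \<and> x * e = x) \<and>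
     (\<forall>x\<in>E. \<forall>y\<in>E. x * y \<in> E) \<and> (\<forall>x\<in>E. \<forall>y\<in>E. x * y = 0 \<longrightarrow> x = 0 \<or> y = 0)"

lemma domain_subalgebraD:
  assumes "domain_subalgebra E e"
  shows "subspace E" "e \<in> E" "e \<noteq> 0" "\<And>x. x \<in> E \<Longrightarrow> e * x = x" "\<And>x. x \<in> E \<Longrightarrow> x * e = x"
    "\<And>x y. x \<in> E \<Longrightarrow> y \<in> E \<Longrightarrow> x * y \<in> E"
    "\<And>x y. x \<in> E \<Longrightarrow> y \<in> E \<Longrightarrow> x * y = 0 \<Longrightarrow> x = 0 \<or> y = 0"
  using assms unfolding domain_subalgebra_def by blast+

text \<open>Left multiplication by \<open>x\<close> is injective, hence onto, which gives a right
  inverse \<open>y\<close>. It is two-sided because \<open>x * (y * x - e) = 0\<close>.\<close>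

lemma domain_subalgebra_inverse:
  assumes E: "domain_subalgebra E e" and x: "x \<in> E" "x \<noteq> 0"
  obtains y where "y \<in> E" "x * y = e" "y * x = e"
proof -
  note E' = domain_subalgebraD[OF E]
  have "(\<lambda>s. x * s) ` E = E"
    using E'(6,7)[OF x(1)] x by (intro inj_endo_imp_surj endo_lmult E'(1)) auto
  then have "e \<in> (\<lambda>s. x * s) ` E" using E'(2) by simp
  then obtain y where y: "e = x * y" "y \<in> E" by (rule imageE)
  have "x * (y * x - e) = 0"
    using E'(4,5)[OF x(1)] by (simp add: right_diff_distrib y(1) flip: mult.assoc)
  moreover have "y * x - e \<in> E"
    using E' x y by (intro subspace_diff) auto
  ultimately have "y * x = e"
    using E'(7)[of x "y * x - e"] x by auto
  then show ?thesis using that y by simp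
qed

text \<open>The regular trace; the reduced trace is \<open>T\<close> divided by
  \<open>red_deg\<close>.\<close>

definition T :: "'v \<Rightarrow> 'f" where
  "T a = trace_on UNIV (\<lambda>s. a * s)"

lemma functional_T: "functional_on UNIV T"
proof -
  have "T (x + y) = T x + T y" for x y
    using trace_on_add[OF subspace_UNIV endo_lmult[of x] endo_lmult[of y]]
    by (simp add: T_def algebra_simps)
  moreover have "T (\<phi> c * x) = c * T x" for c x
    using trace_on_scale[OF subspace_UNIV endo_lmult[of x], of c]
    by (simp add: T_def mult.assoc)
  ultimately show ?thesis by (simp add: functional_on_def)
qed

lemma T_add: "T (x + y) = T x + T y"
  and T_scale: "T (\<phi> c * x) = c * T x"
  and T_0 [simp]: "T 0 = 0"
  and T_diff: "T (x - y) = T x - T y"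
  and T_sum: "T (\<Sum>i\<in>I. v i) = (\<Sum>i\<in>I. T (v i))"
  by (rule functional_on_add[OF functional_T] functional_on_scale[OF functional_T]
      functional_on_0[OF functional_T] functional_on_diff[OF functional_T]
      functional_on_sum[OF functional_T], simp_all)+

lemma T_commute: "T (x * y) = T (y * x)"
  using trace_cyclic[OF endo_lmult[of x] endo_lmult[of y]] by (simp add: T_def mult.assoc)

lemma T_1: "T 1 = of_nat (dim UNIV)"
  by (simp add: T_def trace_on_id del: dim_UNIV)

text \<open>Left multiplication by \<open>e\<close> maps into \<open>e S\<close> and is the identity
  there.\<close>

lemma T_idempotent:
  assumes "e * e = e" "subspace ((\<lambda>s. e * s) ` UNIV)"
  shows "T e = of_nat (dim ((\<lambda>s. e * s) ` UNIV))"
proof -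
  have "T e = trace_on ((\<lambda>s. e * s) ` UNIV) (\<lambda>s. e * s)"
    unfolding T_def by (intro trace_on_image assms endo_lmult) auto
  also have "\<dots> = trace_on ((\<lambda>s. e * s) ` UNIV) (\<lambda>s. s)"
    by (intro trace_on_cong assms endo_lmult endo_id)
      (auto simp: assms(1) simp flip: mult.assoc)
  finally show ?thesis using assms by (simp add: trace_on_id)
qed

text \<open>Peel off copies \<open>E v\<close> of the regular module: \<open>U + E v\<close> is direct as soon as \<open>v\<close> is not
  in \<open>U\<close>, because every nonzero element of \<open>E\<close> is invertible.\<close>
lemma trace_on_module:
  assumes E: "domain_subalgebra E e" and V: "subspace V"
    and act: "\<And>x v. x \<in> E \<Longrightarrow> v \<in> V \<Longrightarrow> x * v \<in> V" "\<And>v. v \<in> V \<Longrightarrow> e * v = v"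
  obtains n where "\<And>x. x \<in> E \<Longrightarrow> trace_on V (\<lambda>s. x * s) = of_nat n * trace_on E (\<lambda>s. x * s)"
    "dim V = n * dim E"
proof -
  note E' = domain_subalgebraD[OF E]
  have dimE: "dim E > 0" using E' by (metis dim_eq_0 gr0I singletonD subsetD)
  \<comment> \<open>A submodule that looks like \<open>n\<close> copies of \<open>E\<close> as far
    as traces can tell; a largest such \<open>n\<close> is taken below.\<close>
  define good where "good n U \<longleftrightarrow> subspace U \<and> U \<subseteq> V \<and> (\<forall>x\<in>E. \<forall>u\<in>U. x * u \<in> U) \<and>
    (\<forall>x\<in>E. trace_on U (\<lambda>s. x * s) = of_nat n * trace_on E (\<lambda>s. x * s))" for n U
  \<comment> \<open>The trace identity at the unit \<open>e\<close> compares traces of identity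
    maps, so it already contains the dimension formula.\<close>
  have dim: "dim U = n * dim E" if "good n U" for n U
  proof -
    have "trace_on U (\<lambda>s. e * s) = of_nat n * trace_on E (\<lambda>s. e * s)"
      using that E' by (simp add: good_def)
    moreover have "trace_on U (\<lambda>s. e * s) = trace_on U (\<lambda>s. s)"
      using that act by (intro trace_on_cong endo_lmult endo_id) (auto simp: good_def E' subset_iff)
    moreover have "trace_on E (\<lambda>s. e * s) = trace_on E (\<lambda>s. s)"
      using E' by (intro trace_on_cong endo_lmult endo_id) auto
    ultimately have "of_nat (dim U) = (of_nat (n * dim E) :: 'f)"
      using that E' by (simp add: trace_on_id good_def)
    then show ?thesis using of_nat_eq_iff by blast
  qed
  have "trace_on {0} (\<lambda>s. x * s) = 0" for x
    using trace_on_cong[OF subspace_single_0 endo_lmult[of x] endo_id] trace_on_id[of "{0}"]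
    by auto
  then have "good 0 {0}"
    using V by (auto simp: good_def subspace_0)
  moreover have bound: "n \<le> dim V" if "\<exists>U. good n U" for n
  proof -
    obtain U where U: "good n U" using \<open>\<exists>U. good n U\<close> by blast
    then have "n * dim E \<le> dim V"
      using dim[OF U] dim_subset[of U V] by (auto simp: good_def)
    then show ?thesis using dimE by (metis le_trans nat_mult_le_cancel_disj mult.right_neutral less_eq_Suc_le One_nat_def)
  qed
  ultimately obtain n where n: "\<exists>U. good n U" "\<And>k. \<exists>U. good k U \<Longrightarrow> k \<le> n"
    using GreatestI_nat[of "\<lambda>n. \<exists>U. good n U" 0 "dim V"]
      Greatest_le_nat[of "\<lambda>n. \<exists>U. good n U" _ "dim V"] by blast
  then obtain U where U: "good n U" by blast
  have "U = V"
  proof (rule ccontr)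
    assume "U \<noteq> V"
    then obtain v where v: "v \<in> V" "v \<notin> U" using U by (auto simp: good_def)
    have sU: "subspace U" and UV: "U \<subseteq> V" and EU: "\<And>x u. x \<in> E \<Longrightarrow> u \<in> U \<Longrightarrow> x * u \<in> U"
      using U by (auto simp: good_def)
    have free: "x = 0" if "x \<in> E" "x * v \<in> U" for x
    proof (rule ccontr)
      assume "x \<noteq> 0"
      then obtain y where "y \<in> E" "y * x = e"
        using domain_subalgebra_inverse[OF E \<open>x \<in> E\<close>] by metis
      then have "v \<in> U" using EU[of y "x * v"] that act v by (simp flip: mult.assoc)
      then show False using v by simp
    qed
    define U' where "U' = {u + x * v |u x. u \<in> U \<and> x \<in> E}"
    \<comment> \<open>The \<open>E\<close>-coordinate along \<open>v\<close> in the direct sum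
      \<open>U + E v\<close>, well defined by \<open>free\<close>.\<close>
    define \<pi> where "\<pi> y = (THE x. x \<in> E \<and> y - x * v \<in> U)" for y
    have \<pi>: "\<pi> (u + x * v) = x" if "u \<in> U" "x \<in> E" for u x
      unfolding \<pi>_def
    proof (rule the_equality)
      fix x' assume x': "x' \<in> E \<and> u + x * v - x' * v \<in> U"
      then have "(u + x * v - x' * v) - u \<in> U" using that sU subspace_diff by blast
      then have "(x - x') * v \<in> U" by (simp add: algebra_simps)
      then show "x' = x" using free[of "x - x'"] x' that E' subspace_diff by fastforce
    qed (use that in auto)
    have U'I: "u + x * v \<in> U'" if "u \<in> U" "x \<in> E" for u x
      using that by (auto simp: U'_def)
    have U'E: thesis if "y \<in> U'" "\<And>u x. y = u + x * v \<Longrightarrow> u \<in> U \<Longrightarrow> x \<in> E \<Longrightarrow> thesis" for y thesis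
      using that by (auto simp: U'_def)
    have sub: "subspace U'"
    proof (rule subspaceI')
      show "0 \<in> U'" using U'I[OF subspace_0[OF sU] subspace_0[OF E'(1)]] by simp
    next
      fix y z assume "y \<in> U'" "z \<in> U'"
      then obtain u x u' x' where yz: "y = u + x * v" "z = u' + x' * v" "u \<in> U" "u' \<in> U" "x \<in> E" "x' \<in> E"
        by (elim U'E) blast
      then show "y + z \<in> U'"
        using U'I[OF subspace_add[OF sU yz(3,4)] subspace_add[OF E'(1) yz(5,6)]]
        by (simp add: algebra_simps)
    next
      fix c y assume "y \<in> U'"
      then obtain u x where "y = u + x * v" "u \<in> U" "x \<in> E" by (rule U'E)
      then show "\<phi> c * y \<in> U'"
        using U'I[OF subspace_phi[OF sU, of u c] subspace_phi[OF E'(1), of x c]]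
        by (simp add: algebra_simps)
    qed
    have act': "x * y \<in> U'" if x: "x \<in> E" and y: "y \<in> U'" for x y
    proof -
      from y obtain u x' where "y = u + x' * v" "u \<in> U" "x' \<in> E" by (rule U'E)
      then show ?thesis
        using U'I[OF EU[of x u] E'(6)[of x x']] x by (simp add: algebra_simps)
    qed
    obtain B f where B: "frame U B (\<lambda>b. b) f"
      by (rule obtain_frame[OF sU])
    note trU = trace_on_frame[OF sU B]
    obtain C h where C: "frame E C (\<lambda>b. b) h"
      by (rule obtain_frame[OF E'(1)])
    note trE = trace_on_frame[OF E'(1) C]
    define w where "w = case_sum (\<lambda>b. b) (\<lambda>c. c * v)"
    define g where "g = case_sum (\<lambda>b y. f b (y - \<pi> y * v)) (\<lambda>c y. h c (\<pi> y))"
    have fr: "frame U' (B <+> C) w g"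
      unfolding frame_def
    proof (intro conjI ballI)
      show "finite (B <+> C)" using frame_finite[OF B] frame_finite[OF C] by simp
      show "w i \<in> U'" if "i \<in> B <+> C" for i
      proof (cases i)
        case (Inl b)
        then have "b \<in> U" using that frame_in[OF B] by auto
        then show ?thesis using Inl U'I[OF _ subspace_0[OF E'(1)], of b] by (simp add: w_def)
      next
        case (Inr c)
        then have "c \<in> E" using that frame_in[OF C] by auto
        then show ?thesis using Inr U'I[OF subspace_0[OF sU], of c] by (simp add: w_def)
      qed
      show "functional_on U' (g i)" if "i \<in> B <+> C" for i
      proof -
        have 0: "\<pi> y \<in> E" "y - \<pi> y * v \<in> U" if "y \<in> U'" for y
          using that \<pi> by (auto elim!: U'E)
        have 1: "\<pi> (y + z) = \<pi> y + \<pi> z" if y: "y \<in> U'" and z: "z \<in> U'" for y z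
        proof -
          from y z obtain u x u' x' where yz: "y = u + x * v" "z = u' + x' * v" "u \<in> U" "u' \<in> U"
              "x \<in> E" "x' \<in> E"
            by (elim U'E) blast
          then have "\<pi> ((u + u') + (x + x') * v) = x + x'"
            using \<pi> subspace_add[OF sU] subspace_add[OF E'(1)] by blast
          moreover have "y + z = (u + u') + (x + x') * v" using yz by (simp add: algebra_simps)
          moreover have "\<pi> y = x" "\<pi> z = x'" using \<pi> yz by auto
          ultimately show ?thesis by simp
        qed
        have 2: "\<pi> (\<phi> c * y) = \<phi> c * \<pi> y" if y: "y \<in> U'" for c y
        proof -
          from y obtain u x where yz: "y = u + x * v" "u \<in> U" "x \<in> E" by (rule U'E)
          then have "\<pi> (\<phi> c * u + (\<phi> c * x) * v) = \<phi> c * x"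
            using \<pi> subspace_phi[OF sU] subspace_phi[OF E'(1)] by blast
          moreover have "\<phi> c * y = \<phi> c * u + (\<phi> c * x) * v" using yz by (simp add: algebra_simps)
          moreover have "\<pi> y = x" using \<pi> yz by auto
          ultimately show ?thesis by simp
        qed
        have 3: "(y + z) - \<pi> (y + z) * v = (y - \<pi> y * v) + (z - \<pi> z * v)"
          if "y \<in> U'" "z \<in> U'" for y z
          using 1[OF that] by (simp add: algebra_simps)
        have 4: "\<phi> c * y - \<pi> (\<phi> c * y) * v = \<phi> c * (y - \<pi> y * v)" if "y \<in> U'" for c y
          using 2[OF that] by (simp add: algebra_simps)
        show ?thesis
        proof (cases i)
          case (Inl b)
          then have fb: "functional_on U (f b)" using that frame_functional[OF B] by auto
          show ?thesis unfolding functional_on_def g_def Inl sum.case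
            by (simp add: 3 4 0 functional_on_add[OF fb] functional_on_scale[OF fb])
        next
          case (Inr c)
          then have hc: "functional_on E (h c)" using that frame_functional[OF C] by auto
          show ?thesis unfolding functional_on_def g_def Inr sum.case
            by (simp add: 1 2 0 functional_on_add[OF hc] functional_on_scale[OF hc])
        qed
      qed
      fix y assume "y \<in> U'"
      then obtain u x where yz: "y = u + x * v" "u \<in> U" "x \<in> E" by (rule U'E)
      have "(\<Sum>i\<in>B <+> C. \<phi> (g i y) * w i) = (\<Sum>b\<in>B. \<phi> (f b u) * b) + (\<Sum>c\<in>C. \<phi> (h c x) * c) * v"
        using yz \<pi> frame_finite[OF B] frame_finite[OF C]
        by (simp add: sum.Plus g_def w_def sum_distrib_right mult.assoc)
      then show "y = (\<Sum>i\<in>B <+> C. \<phi> (g i y) * w i)"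
        using yz frame_expand[OF B yz(2)] frame_expand[OF C yz(3)] by argo
    qed
    have "good (Suc n) U'"
      unfolding good_def
    proof (intro conjI ballI sub act')
      show "U' \<subseteq> V"
        using UV v act by (auto simp: U'_def intro!: subspace_add[OF V])
      fix x assume x: "x \<in> E"
      have "trace_on U' (\<lambda>s. x * s) = (\<Sum>i\<in>B <+> C. g i (x * w i))"
        using act' x by (intro trace_on_frame[OF sub fr] endo_lmult) auto
      also have "\<dots> = (\<Sum>b\<in>B. f b (x * b)) + (\<Sum>c\<in>C. h c (x * c))"
      proof -
        have "f b (x * b - \<pi> (x * b) * v) = f b (x * b)" if "b \<in> B" for b
          using \<pi>[of "x * b" 0] EU[OF x frame_in[OF B that]] subspace_0[OF E'(1)] by simp
        moreover have "\<pi> (x * (c * v)) = x * c" if "c \<in> C" for c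
          using \<pi>[of 0 "x * c"] E'(6)[OF x frame_in[OF C that]] subspace_0[OF sU]
          by (simp add: mult.assoc)
        ultimately show ?thesis
          using frame_finite[OF B] frame_finite[OF C] by (simp add: sum.Plus g_def w_def)
      qed
      also have "\<dots> = trace_on U (\<lambda>s. x * s) + trace_on E (\<lambda>s. x * s)"
        using trU[OF endo_lmult[of x]] trE[OF endo_lmult[of x]] x EU E' by simp
      also have "\<dots> = of_nat (Suc n) * trace_on E (\<lambda>s. x * s)"
        using U x by (simp add: good_def algebra_simps)
      finally show "trace_on U' (\<lambda>s. x * s) = of_nat (Suc n) * trace_on E (\<lambda>s. x * s)" .
    qed
    then show False using n(2)[of "Suc n"] by auto
  qed
  then show ?thesis using that[of n] dim[OF U] U by (auto simp: good_def)
qed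

end

section \<open>Prime algebras: primitive idempotents, the trace form and the centre\<close>

locale prime_fd_algebra = fd_central_algebra \<phi> Basis
  for \<phi> :: "'f::field_char_0 \<Rightarrow> 'v::ring_1" and Basis +
  assumes prime: "(\<And>x. (a::'v) * x * b = 0) \<Longrightarrow> a = 0 \<or> b = 0"
begin

definition right_ideal :: "'v set \<Rightarrow> bool" where
  "right_ideal J \<longleftrightarrow> subspace J \<and> (\<forall>x\<in>J. \<forall>s. x * s \<in> J)"

text \<open>A nonzero right ideal \<open>J\<close> inside \<open>I\<close> of least dimension
  behaves like a simple module: a left multiplication on \<open>J\<close> is zero or injective. This
  yields both the idempotent and, as in Schur's lemma, the absence of zero divisors in its
  corner.\<close>

lemma primitive_idempotent_exists:
  assumes I: "right_ideal I" "b \<in> I" "b \<noteq> 0"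
  obtains e where "e \<in> I" "e * e = e" "domain_subalgebra {e * s * e |s. True} e"
proof -
  define Q where "Q J \<longleftrightarrow> right_ideal J \<and> J \<subseteq> I \<and> (\<exists>x\<in>J. x \<noteq> 0)" for J
  have "Q I" using I by (auto simp: Q_def)
  then obtain J where J: "Q J" "\<And>K. Q K \<Longrightarrow> dim J \<le> dim K"
    using ex_has_least_nat[of Q I dim] by blast
  then have J': "subspace J" "\<And>x s. x \<in> J \<Longrightarrow> x * s \<in> J" "J \<subseteq> I"
    by (auto simp: Q_def right_ideal_def)
  obtain b where b: "b \<in> J" "b \<noteq> 0" using J by (auto simp: Q_def)
  \<comment> \<open>The elements of \<open>J\<close> killed by \<open>a\<close> form a right ideal,
    which by minimality is \<open>0\<close> or \<open>J\<close>.\<close>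
  have kernel: "s = 0" if "s \<in> J" "a * s = 0" "t \<in> J" "a * t \<noteq> 0" for a s t
  proof (rule ccontr)
    assume "s \<noteq> 0"
    define K where "K = {s \<in> J. a * s = 0}"
    have "subspace K"
      unfolding K_def using J'(1)
      by (intro subspaceI') (auto simp: subspace_0 subspace_add subspace_phi algebra_simps phi_left_commute)
    then have "Q K"
      using J' that \<open>s \<noteq> 0\<close> by (auto simp: Q_def right_ideal_def K_def simp flip: mult.assoc)
    then have "K = J"
      using J(2) J' \<open>subspace K\<close> by (intro subspace_dim_equal) (auto simp: K_def)
    then show False using that by (auto simp: K_def)
  qed
  obtain x where x: "b * x * b \<noteq> 0" using prime[of b b] b by blast
  define a where "a = b * x"
  have a: "a \<in> J" "a * b \<noteq> 0" using x b J' by (auto simp: a_def)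
  \<comment> \<open>Since \<open>a\<close> lies in \<open>J\<close> and acts bijectively on
    \<open>J\<close>, the equation \<open>a = a * e\<close> is solvable in \<open>J\<close>;
    injectivity then makes \<open>e\<close> idempotent.\<close>
  have "(\<lambda>s. a * s) ` J = J"
    using a b J' kernel[of _ a b] by (intro inj_endo_imp_surj endo_lmult) auto
  then have "a \<in> (\<lambda>s. a * s) ` J" using a by simp
  then obtain e where e': "a = a * e" "e \<in> J" by (rule imageE)
  then have e: "e \<in> J" "a * e = a" by simp_all
  have "a * (e * e - e) = 0" using e by (simp add: algebra_simps flip: mult.assoc)
  moreover have "e * e - e \<in> J" using J' e by (intro subspace_diff) auto
  ultimately have ee: "e * e = e" using kernel[of "e * e - e" a b] a b by auto
  have e0: "e \<noteq> 0" using e a by auto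
  have "domain_subalgebra {e * s * e |s. True} e"
    unfolding domain_subalgebra_def
  proof (intro conjI ballI impI)
    show "subspace {e * s * e |s. True}"
    proof (rule subspaceI')
      show "0 \<in> {e * s * e |s. True}" by (auto intro!: exI[of _ 0])
    next
      fix x y assume "x \<in> {e * s * e |s. True}" "y \<in> {e * s * e |s. True}"
      then obtain s t where "x = e * s * e" "y = e * t * e" by auto
      then show "x + y \<in> {e * s * e |s. True}"
        by (auto intro!: exI[of _ "s + t"] simp: algebra_simps)
    next
      fix c x assume "x \<in> {e * s * e |s. True}"
      then obtain s where "x = e * s * e" by auto
      then show "\<phi> c * x \<in> {e * s * e |s. True}"
        by (auto intro!: exI[of _ "\<phi> c * s"] simp: mult.assoc phi_left_commute)
    qed
    show "e \<in> {e * s * e |s. True}" using ee by (auto intro!: exI[of _ e])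
    show "e \<noteq> 0" by (rule e0)
    fix x assume "x \<in> {e * s * e |s. True}"
    then obtain s where s: "x = e * s * e" by auto
    show "e * x = x" using s ee by (simp flip: mult.assoc)
    show xe: "x * e = x" using s ee by (simp add: mult.assoc)
    fix y assume "y \<in> {e * s * e |s. True}"
    then obtain t where t: "y = e * t * e" by auto
    show "x * y \<in> {e * s * e |s. True}"
      using s t by (auto intro!: exI[of _ "s * e * e * t"] simp: mult.assoc)
    assume "x * y = 0"
    then show "x = 0 \<or> y = 0"
      using kernel[of y x e] e(1) J'(2)[OF e(1), of "t * e"] t xe by (auto simp: mult.assoc)
  qed
  then show ?thesis using that e J' ee by blast
qed

text \<open>The radical of the form is a right ideal. An idempotent \<open>e\<close> in it would
  have trace 0, but its trace is the dimension of \<open>e S\<close>.\<close>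

lemma T_nondegenerate:
  assumes "\<And>x. T (a * x) = 0"
  shows "a = 0"
proof (rule ccontr)
  assume "a \<noteq> 0"
  define I where "I = {a. \<forall>x. T (a * x) = 0}"
  have "right_ideal I"
    unfolding right_ideal_def I_def
    by (auto intro!: subspaceI' simp: algebra_simps T_add T_scale)
  then obtain e where e: "e \<in> I" "e * e = e" "domain_subalgebra {e * s * e |s. True} e"
    using primitive_idempotent_exists[of I a] assms \<open>a \<noteq> 0\<close> by (auto simp: I_def)
  let ?V = "(\<lambda>s. e * s) ` UNIV"
  have V: "subspace ?V" by (intro subspace_endo_image endo_lmult subspace_UNIV)
  have "T (e * 1) = 0" using e(1) unfolding I_def by blast
  then have "T e = 0" by simp
  then have "dim ?V = 0" using T_idempotent[OF e(2) V] by simp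
  then have "?V \<subseteq> {0}" by (simp only: dim_eq_0)
  then have "e * 1 \<in> {0}" by blast
  then show False using domain_subalgebraD(3)[OF e(3)] by simp
qed

lemma center_commute: "z \<in> ring_center \<Longrightarrow> z * x = x * z"
  unfolding ring_center_def by blast

lemma center_domain: "domain_subalgebra ring_center 1"
  unfolding domain_subalgebra_def
proof (intro conjI ballI impI)
  show "subspace ring_center"
    by (intro subspaceI') (auto simp: ring_center_def algebra_simps phi_left_commute)
  fix x y :: 'v assume x: "x \<in> ring_center" "y \<in> ring_center"
  show "x * y \<in> ring_center"
    unfolding ring_center_def mem_Collect_eq
  proof
    fix s
    show "x * y * s = s * (x * y)"
      using center_commute[OF x(1), of s] center_commute[OF x(2), of s] by (metis mult.assoc)
  qed
  assume "x * y = 0"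
  then have "x * s * y = 0" for s
    using center_commute[OF x(1), of s] by (simp add: mult.assoc)
  then show "x = 0 \<or> y = 0" by (rule prime)
qed (auto simp: ring_center_def)

text \<open>The vector \<open>c\<close> representing \<open>t\<close> is central because symmetry of
  \<open>t\<close> and of \<open>T\<close> gives \<open>T ((c x - x c) y) = 0\<close> for all
  \<open>y\<close>.\<close>

lemma symmetric_functional:
  assumes t: "functional_on UNIV t" and sym: "\<And>x y. t (x * y) = t (y * x)"
  shows "\<exists>c\<in>ring_center. \<forall>x. t x = T (c * x)"
proof -
  obtain c where c: "\<forall>x. T (c * x) = t x"
    using riesz[OF subspace_UNIV functional_T _ t] T_nondegenerate by auto
  have "c * x = x * c" for x
  proof -
    have "T ((c * x - x * c) * y) = 0" for y
      using c[rule_format, of "x * y"] c[rule_format, of "y * x"] sym[of x y] T_commute[of x "c * y"]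
      by (simp add: left_diff_distrib T_diff mult.assoc)
    then show ?thesis using T_nondegenerate[of "c * x - x * c"] by auto
  qed
  then have "c \<in> ring_center" unfolding ring_center_def by blast
  then show ?thesis using c by (intro bexI[of _ c]) simp_all
qed

end

subsection \<open>Newton identities and a logarithmic differential equation\<close>

lemma newton_e_Suc_mult:
  fixes ps :: "nat \<Rightarrow> 'f::field_char_0"
  shows "of_nat (Suc i) * newton_e ps (Suc i) = (\<Sum>k\<in>{1..Suc i}. (-1)^(k-1) * newton_e ps (Suc i - k) * ps k)"
  by (simp del: of_nat_Suc)

lemma max_power_decomposition:
  fixes g p :: "'a::field poly"
  assumes "degree g > 0" "p \<noteq> 0"
  shows "\<exists>b H. p = g ^ b * H \<and> \<not> g dvd H"
  using assms(2)
proof (induction "degree p" arbitrary: p rule: less_induct)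
  case less
  show ?case
  proof (cases "g dvd p")
    case True
    then obtain r where r: "p = g * r" by auto
    with less.prems have "r \<noteq> 0" "degree r < degree p"
      using assms(1) by (auto simp: degree_mult_eq)
    then obtain b H where "r = g ^ b * H" "\<not> g dvd H" using less.hyps by blast
    then show ?thesis using r by (intro exI[of _ "Suc b"] exI[of _ H]) (simp add: mult.assoc)
  next
    case False
    then show ?thesis by (intro exI[of _ 0] exI[of _ p]) simp
  qed
qed

text \<open>With \<open>G = \<Sum> (-1)^i e_i X^i\<close> and \<open>P = \<Sum> p_k X^k\<close>, Newton's identities say \<open>X G' = - G P\<close>, and
  the recurrence says that \<open>W = g P\<close> is a polynomial, so \<open>g X G' = - G W\<close>. Since \<open>g\<close> is
  irreducible, this logarithmic differential equation forces \<open>G\<close> to be a constant multiple of a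
  power \<open>g^b\<close>, whence \<open>W = - b X g'\<close>.\<close>
lemma newton_power_sums:
  fixes ps :: "nat \<Rightarrow> 'f::field_char_0" and g :: "'f poly"
  assumes van: "\<And>i. i > m \<Longrightarrow> newton_e ps i = 0"
    and cop: "\<And>H. \<not> g dvd H \<Longrightarrow> \<exists>u v. u * g + v * H = 1"
    and deg: "degree g = q" "q > 0" and g0: "coeff g 0 \<noteq> 0"
    and rec: "\<And>k. k > q \<Longrightarrow> (\<Sum>i\<le>q. coeff g i * ps (k - i)) = 0"
  shows "\<exists>b. (\<Sum>i<q. coeff g i * ps (q - i)) = - of_nat (b * q) * coeff g q \<and>
    coeff g 0 * ps 1 = - of_nat b * coeff g 1"
proof -
  \<comment> \<open>The constant term is forced to 0: \<open>ps 0\<close> does not occur in Newton's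
    identities.\<close>
  define P where "P = Abs_fps (\<lambda>k. if k = 0 then 0 else ps k)"
  \<comment> \<open>Cutting off at \<open>m\<close>, and below at \<open>q\<close>, makes
    \<open>G\<close> and \<open>W\<close> polynomials; by \<open>van\<close> and \<open>rec\<close>
    nothing is lost.\<close>
  define G where "G = (\<Sum>i\<le>m. monom ((-1) ^ i * newton_e ps i) i)"
  define W where "W = (\<Sum>k\<le>q. monom (fps_nth (fps_of_poly g * P) k) k)"
  have P: "fps_nth P k = (if k = 0 then 0 else ps k)" for k by (simp add: P_def)
  have G: "coeff G i = (-1) ^ i * newton_e ps i" for i
    by (cases "i \<le> m") (auto simp: G_def coeff_sum van)
  have gP: "fps_nth (fps_of_poly g * P) k = (\<Sum>i\<le>q. coeff g i * (if i < k then ps (k - i) else 0))" for k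
  proof -
    have "fps_nth (fps_of_poly g * P) k = (\<Sum>i\<in>{0..k}. coeff g i * (if i < k then ps (k - i) else 0))"
      by (auto simp: fps_mult_nth P intro!: sum.cong)
    also have "\<dots> = (\<Sum>i\<in>{0..max k q}. coeff g i * (if i < k then ps (k - i) else 0))"
      by (rule sum.mono_neutral_left) auto
    also have "\<dots> = (\<Sum>i\<le>q. coeff g i * (if i < k then ps (k - i) else 0))"
      by (rule sum.mono_neutral_right) (auto simp: coeff_eq_0 deg)
    finally show ?thesis .
  qed
  have W: "fps_of_poly W = fps_of_poly g * P"
  proof (rule fps_ext)
    fix k
    have "fps_nth (fps_of_poly g * P) k = 0" if "k > q"
      using rec[OF that] that by (simp add: gP)
    then show "fps_nth (fps_of_poly W) k = fps_nth (fps_of_poly g * P) k"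
      by (cases "k \<le> q") (auto simp: W_def coeff_sum)
  qed
  have XG: "fps_X * fps_deriv (fps_of_poly G) = - (P * fps_of_poly G)"
  proof (rule fps_ext)
    fix n
    show "fps_nth (fps_X * fps_deriv (fps_of_poly G)) n = fps_nth (- (P * fps_of_poly G)) n"
    proof (cases n)
      case 0
      then show ?thesis by (simp add: P)
    next
      case (Suc i)
      have "fps_nth (P * fps_of_poly G) (Suc i) = (\<Sum>k\<in>{0..Suc i}. fps_nth P k * coeff G (Suc i - k))"
        by (simp add: fps_mult_nth)
      also have "\<dots> = (\<Sum>k\<in>{1..Suc i}. fps_nth P k * coeff G (Suc i - k))"
        by (rule sum.mono_neutral_right) (auto simp: P not_less_eq_eq)
      also have "\<dots> = (\<Sum>k\<in>{1..Suc i}. - ((-1) ^ Suc i) * ((-1)^(k-1) * newton_e ps (Suc i - k) * ps k))"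
      proof (rule sum.cong[OF refl])
        fix k assume k: "k \<in> {1..Suc i}"
        then have "(-1) ^ (Suc i - k) = - ((-1) ^ Suc i) * ((-1 :: 'f) ^ (k - 1))"
          by (auto simp: uminus_power_if minus_one_power_iff)
        then show "fps_nth P k * coeff G (Suc i - k) =
            - ((-1) ^ Suc i) * ((-1)^(k-1) * newton_e ps (Suc i - k) * ps k)"
          using k by (simp add: P G del: power_Suc)
      qed
      also have "\<dots> = - ((-1) ^ Suc i) * (of_nat (Suc i) * newton_e ps (Suc i))"
        unfolding newton_e_Suc_mult by (simp only: sum_distrib_left)
      finally show ?thesis using Suc by (simp add: G algebra_simps del: of_nat_Suc newton_e.simps)
    qed
  qed
  define X :: "'f poly" where "X = [:0, 1:]"
  have X: "fps_of_poly X = fps_X" "coeff (X * p) 0 = 0" "coeff (X * p) (Suc i) = coeff p i"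
    "p \<noteq> 0 \<Longrightarrow> degree (X * p) = Suc (degree p)" "X \<noteq> 0" for p i
    by (simp_all add: X_def fps_of_poly_pCons)
  have "fps_of_poly (g * (X * pderiv G)) = fps_of_poly (- (G * W))"
  proof -
    have "fps_of_poly (g * (X * pderiv G)) = fps_of_poly g * (fps_X * fps_deriv (fps_of_poly G))"
      by (simp add: fps_of_poly_mult X fps_of_poly_pderiv)
    also have "\<dots> = - (fps_of_poly G * fps_of_poly W)"
      by (simp add: XG W algebra_simps)
    finally show ?thesis by (simp add: fps_of_poly_mult fps_of_poly_uminus)
  qed
  then have ode: "g * (X * pderiv G) = - (G * W)"
    by (simp only: fps_of_poly_eq_iff)
  have "coeff G 0 = 1" by (simp add: G)
  then have "G \<noteq> 0" by auto
  then obtain b H where bH: "G = g ^ b * H" "\<not> g dvd H"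
    using max_power_decomposition[of g G] deg by auto
  \<comment> \<open>Written without the exponent \<open>b - 1\<close>, so that \<open>b = 0\<close>
    is included.\<close>
  have gb: "g * pderiv (g ^ b) = of_nat b * (g ^ b * pderiv g)"
  proof (cases b)
    case (Suc n)
    have "of_nat b * (g ^ b * pderiv g) = Polynomial.smult (of_nat b) (g ^ b * pderiv g)"
      by (simp add: of_nat_poly)
    then show ?thesis unfolding Suc pderiv_power_Suc by (simp add: mult.assoc del: of_nat_Suc)
  qed simp
  have "g ^ b * (of_nat b * (X * pderiv g) * H + g * (X * pderiv H)) = g ^ b * (- (H * W))"
  proof -
    have "g ^ b * (of_nat b * (X * pderiv g) * H + g * (X * pderiv H)) =
        X * ((of_nat b * (g ^ b * pderiv g)) * H + g * (g ^ b * pderiv H))"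
      by (simp add: algebra_simps)
    also have "\<dots> = g * (X * pderiv G)"
      unfolding bH(1) pderiv_mult gb[symmetric] by (simp add: algebra_simps)
    finally show ?thesis using ode bH(1) by simp
  qed
  then have *: "of_nat b * (X * pderiv g) * H + g * (X * pderiv H) = - (H * W)"
    by (rule mult_left_cancel[THEN iffD1, rotated]) (use deg in auto)
  have "g * (X * pderiv H) = H * (- W - of_nat b * (X * pderiv g))"
    using * by (simp add: algebra_simps)
  then have dvd1: "H dvd g * (X * pderiv H)" by simp
  obtain u v where "u * g + v * H = 1" using cop[OF bH(2)] by blast
  then have "X * pderiv H = (u * g + v * H) * (X * pderiv H)" by simp
  also have "\<dots> = u * (g * (X * pderiv H)) + H * (v * (X * pderiv H))"
    by (simp add: algebra_simps)
  finally have "H dvd X * pderiv H"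
    using dvd1 by (metis dvd_add dvd_mult dvd_triv_left)
  then obtain K where K: "X * pderiv H = H * K" by auto
  have H0: "coeff H 0 \<noteq> 0"
    using \<open>coeff G 0 = 1\<close> by (auto simp: bH coeff_mult_0 )
  \<comment> \<open>If \<open>H'\<close> were nonzero, \<open>X H'\<close> would have the degree of
    \<open>H\<close>, so the quotient \<open>K\<close> would be a nonzero constant. But
    \<open>X H'\<close> has constant term 0 while \<open>H\<close> does not.\<close>
  have dH: "pderiv H = 0"
  proof (rule ccontr)
    assume nz: "pderiv H \<noteq> 0"
    then have "degree H \<noteq> 0" by (auto simp: pderiv_eq_0_iff)
    then have "degree (X * pderiv H) = degree H"
      using nz by (simp add: X degree_pderiv)
    moreover have "K \<noteq> 0" "H \<noteq> 0" using K nz X(5) by auto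
    ultimately have "degree K = 0" using K by (simp add: degree_mult_eq)
    then obtain \<kappa> where "K = [:\<kappa>:]" by (rule degree_eq_zeroE)
    then have "coeff H 0 * \<kappa> = coeff (X * pderiv H) 0" unfolding K by simp
    then show False using H0 \<open>K = [:\<kappa>:]\<close> \<open>K \<noteq> 0\<close> X(2) by simp
  qed
  have "H \<noteq> 0" using H0 by auto
  have "H * (of_nat b * (X * pderiv g) + W) = 0"
    using * dH by (simp add: algebra_simps)
  then have Wb: "W = - (of_nat b * (X * pderiv g))"
    using \<open>H \<noteq> 0\<close> by (simp add: eq_neg_iff_add_eq_0 add.commute)
  have cW: "coeff W (Suc i) = - of_nat b * (of_nat (Suc i) * coeff g (Suc i))" for i
    unfolding Wb by (simp add: of_nat_poly coeff_pderiv X)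
  have "coeff W k = fps_nth (fps_of_poly g * P) k" for k
    using W by (metis fps_of_poly_nth)
  note cW' = this[unfolded gP]
  \<comment> \<open>The term \<open>i = q\<close> is absent since \<open>P\<close> has no constant
    term; the caller supplies it as a multiple of \<open>t e\<close>.\<close>
  have "(\<Sum>i<q. coeff g i * ps (q - i)) = coeff W q"
    unfolding cW' lessThan_Suc_atMost[symmetric] sum.lessThan_Suc by simp
  also have "\<dots> = - of_nat (b * q) * coeff g q"
    using cW[of "q - 1"] deg(2) by simp
  finally have 1: "(\<Sum>i<q. coeff g i * ps (q - i)) = - of_nat (b * q) * coeff g q" .
  have "coeff W 1 = (\<Sum>i\<le>q. if i = 0 then coeff g 0 * ps 1 else 0)"
    unfolding cW' by (rule sum.cong) auto
  then have "coeff g 0 * ps 1 = coeff W 1" by simp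
  also have "\<dots> = - of_nat b * coeff g 1" using cW[of 0] by simp
  finally show ?thesis using 1 by blast
qed

subsection \<open>Simple extensions inside a domain subalgebra\<close>

context fd_central_algebra
begin

text \<open>Evaluation of a polynomial at \<open>w\<close> in a subalgebra whose unit \<open>e\<close> need not be \<open>1\<close>.\<close>
definition peval :: "'v \<Rightarrow> 'v \<Rightarrow> 'f poly \<Rightarrow> 'v" where
  "peval e w p = fold_coeffs (\<lambda>a s. \<phi> a * e + w * s) p 0"

lemma peval_0 [simp]: "peval e w 0 = 0"
  by (simp add: peval_def)

lemma peval_pCons: "peval e w (pCons a p) = \<phi> a * e + w * peval e w p"
  by (cases "a = 0 \<and> p = 0") (auto simp: peval_def)

lemma peval_const: "peval e w [:a:] = \<phi> a * e"
  by (simp add: peval_pCons)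

lemma peval_add: "peval e w (p + q) = peval e w p + peval e w q"
  by (induction p q rule: poly_induct2) (auto simp: peval_pCons phi_add algebra_simps)

lemma peval_smult: "peval e w (Polynomial.smult c p) = \<phi> c * peval e w p"
  by (induction p) (auto simp: peval_pCons phi_mult distrib_left mult.assoc phi_left_commute[of w])

lemma peval_sum: "peval e w (\<Sum>i\<in>I. p i) = (\<Sum>i\<in>I. peval e w (p i))"
  by (induction I rule: infinite_finite_induct) (auto simp: peval_add)

definition ch_at :: "('v \<Rightarrow> 'f) \<Rightarrow> nat \<Rightarrow> 'v \<Rightarrow> bool" where
  "ch_at t m x \<longleftrightarrow>
     x ^ m + (\<Sum>i\<in>{1..m}. \<phi> ((-1)^i * newton_e (\<lambda>k. t (x ^ k)) i) * x ^ (m - i)) = 0"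

text \<open>Multiply the Cayley-Hamilton identity by \<open>x ^ (i - m)\<close> and apply
  \<open>t\<close>. Up to sign the result is Newton's formula for \<open>i * e_i\<close>, in which
  the terms with index strictly between \<open>m\<close> and \<open>i\<close> vanish by
  induction.\<close>

lemma newton_e_vanishes:
  assumes t: "functional_on UNIV t" and ch: "ch_at t m x" and "i > m"
  shows "newton_e (\<lambda>k. t (x ^ k)) i = 0"
  using assms(3)
proof (induction i rule: less_induct)
  case (less i)
  define e where "e = newton_e (\<lambda>k. t (x ^ k))"
  obtain i' where i': "i = Suc i'" using less.prems by (cases i) auto
  have e0: "e 0 = 1" by (simp add: e_def)
  have "x ^ (i - m) * (x ^ m + (\<Sum>l\<in>{1..m}. \<phi> ((-1)^l * e l) * x ^ (m - l))) = 0"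
    using ch by (simp add: ch_at_def e_def)
  moreover have "x ^ (i - m) * (x ^ m + (\<Sum>l\<in>{1..m}. \<phi> ((-1)^l * e l) * x ^ (m - l))) =
      x ^ i + (\<Sum>l\<in>{1..m}. \<phi> ((-1)^l * e l) * x ^ (i - l))"
  proof -
    have "x ^ (i - m) * x ^ (m - l) = x ^ (i - l)" if "l \<le> m" for l
      using that less.prems by (simp flip: power_add)
    then show ?thesis
      using less.prems by (simp add: distrib_left sum_distrib_left phi_left_commute flip: power_add)
  qed
  also have "\<dots> = (\<Sum>l\<in>{0..m}. \<phi> ((-1)^l * e l) * x ^ (i - l))"
    by (subst sum.atLeast_Suc_atMost) (auto simp: e0)
  finally have "t (\<Sum>l\<in>{0..m}. \<phi> ((-1)^l * e l) * x ^ (i - l)) = 0"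
    using t by (simp add: functional_on_0)
  then have s0: "(\<Sum>l\<in>{0..m}. (-1)^l * e l * t (x ^ (i - l))) = 0"
    by (subst (asm) functional_on_lincomb[OF t subspace_UNIV]) auto
  have "of_nat i * e i = (\<Sum>k\<in>{1..i}. (-1)^(k-1) * e (i - k) * t (x ^ k))"
    using newton_e_Suc_mult[of i' "\<lambda>k. t (x ^ k)"] by (simp only: e_def i')
  also have "\<dots> = (\<Sum>l\<in>{0..<i}. (-1)^(i - l - 1) * e l * t (x ^ (i - l)))"
    by (rule sum.reindex_bij_witness[of _ "\<lambda>l. i - l" "\<lambda>k. i - k"]) auto
  also have "\<dots> = (\<Sum>l\<in>{0..m}. (-1)^(i - l - 1) * e l * t (x ^ (i - l)))"
    using less by (intro sum.mono_neutral_right) (auto simp: e_def)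
  also have "\<dots> = (\<Sum>l\<in>{0..m}. (-1)^i' * ((-1)^l * e l * t (x ^ (i - l))))"
  proof (rule sum.cong[OF refl])
    fix l assume "l \<in> {0..m}"
    then have "(-1)^(i - l - 1) = (-1)^i' * (-1 :: 'f)^l"
      using less.prems by (auto simp: i' minus_one_power_iff)
    then show "(-1)^(i - l - 1) * e l * t (x ^ (i - l)) = (-1)^i' * ((-1)^l * e l * t (x ^ (i - l)))"
      by simp
  qed
  also have "\<dots> = 0" using s0 by (simp flip: sum_distrib_left)
  finally show ?case using i' by (simp add: e_def del: newton_e.simps of_nat_Suc)
qed

section \<open>One element of a domain subalgebra: minimal polynomial and generated field\<close>

context
  fixes E e w
  assumes E: "domain_subalgebra E e" and w: "w \<in> E"
begin

lemma unit_mult [simp]: "x \<in> E \<Longrightarrow> e * x = x" "x \<in> E \<Longrightarrow> x * e = x"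
  using domain_subalgebraD[OF E] by auto

lemma peval_in: "peval e w p \<in> E"
proof (induction p)
  case (pCons a p)
  then show ?case unfolding peval_pCons using domain_subalgebraD[OF E] w
    by (intro subspace_add subspace_phi) auto
qed (use domain_subalgebraD[OF E] in \<open>auto simp: subspace_0\<close>)

lemma peval_1: "peval e w 1 = e"
  by (simp add: one_pCons peval_const)

lemma peval_X: "peval e w [:0, 1:] = w"
  by (simp add: peval_pCons w)

lemma peval_mult: "peval e w (p * q) = peval e w p * peval e w q"
proof (induction p)
  case (pCons a p)
  have "e * peval e w q = peval e w q" using peval_in by simp
  then show ?case
    by (simp add: peval_add peval_smult peval_pCons pCons distrib_right mult.assoc)
qed simp

text \<open>\<open>e * w ^ i\<close> is the power of \<open>w\<close> taken in the algebra with unit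
  \<open>e\<close>; the factor \<open>e\<close> matters only for \<open>i = 0\<close>.\<close>

lemma power_step: "e * w ^ Suc i = w * (e * w ^ i)"
  using w by (simp flip: mult.assoc)

lemma peval_monom: "peval e w (monom c i) = \<phi> c * (e * w ^ i)"
  by (induction i) (simp_all add: monom_0 monom_Suc peval_const peval_pCons phi_left_commute
      power_step del: power_Suc)

lemma peval_expand:
  assumes "degree p \<le> n"
  shows "peval e w p = (\<Sum>i\<le>n. \<phi> (coeff p i) * (e * w ^ i))"
proof -
  have "p = (\<Sum>i\<le>n. monom (coeff p i) i)"
    using assms by (simp add: poly_as_sum_of_monoms')
  then have "peval e w p = peval e w (\<Sum>i\<le>n. monom (coeff p i) i)" by (rule arg_cong)
  then show ?thesis by (simp only: peval_sum peval_monom)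
qed

text \<open>Too many powers of \<open>w\<close> for the dimension. Since dependence concerns sets, a
  coincidence between two powers is treated separately.\<close>

lemma annihilating_poly_exists: "\<exists>p. p \<noteq> 0 \<and> peval e w p = 0"
proof (cases "inj_on (\<lambda>i. e * w ^ i) {..dim UNIV}")
  case False
  then obtain i k where ik: "i \<noteq> k" "e * w ^ i = e * w ^ k" by (auto simp: inj_on_def)
  have "peval e w (monom 1 i + monom (-1) k) = 0"
    using ik by (simp add: peval_add peval_monom phi_minus)
  moreover have "monom 1 i + monom (-1 :: 'f) k \<noteq> 0"
    using ik(1) by (auto simp: poly_eq_iff intro!: exI[of _ i])
  ultimately show ?thesis by blast
next
  case True
  let ?S = "(\<lambda>i. e * w ^ i) ` {..dim UNIV}"
  have "card ?S = Suc (dim UNIV)" using card_image[OF True] by simp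
  then have "dependent ?S"
    using independent_card_le_dim[of ?S UNIV] by (auto simp del: dim_UNIV)
  then obtain u v where u: "v \<in> ?S" "u v \<noteq> 0" "(\<Sum>v\<in>?S. fscale \<phi> (u v) v) = 0"
    using dependent_finite[of ?S] by auto
  let ?p = "\<Sum>i\<le>dim UNIV. monom (u (e * w ^ i)) i"
  have "peval e w ?p = (\<Sum>i\<le>dim UNIV. \<phi> (u (e * w ^ i)) * (e * w ^ i))"
    by (simp only: peval_sum peval_monom)
  also have "\<dots> = 0" using u(3) by (simp add: sum.reindex[OF True] fscale_def del: dim_UNIV)
  finally have "peval e w ?p = 0" .
  moreover have "?p \<noteq> 0"
  proof -
    from u(1) obtain i where "i \<le> dim UNIV" "v = e * w ^ i" by (auto simp del: dim_UNIV)
    then have "coeff ?p i \<noteq> 0" using u(2) by (simp add: coeff_sum del: dim_UNIV)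
    then show ?thesis by auto
  qed
  ultimately show ?thesis by blast
qed

text \<open>Not normalised to be monic: the trace formulas below are homogeneous in the coefficients
  of \<open>g\<close>.\<close>

definition minimal_poly :: "'f poly \<Rightarrow> bool" where
  "minimal_poly g \<longleftrightarrow> g \<noteq> 0 \<and> peval e w g = 0 \<and>
     (\<forall>p. p \<noteq> 0 \<longrightarrow> peval e w p = 0 \<longrightarrow> degree g \<le> degree p)"

lemma minimal_poly_exists: "\<exists>g. minimal_poly g"
proof -
  obtain p where "p \<noteq> 0 \<and> peval e w p = 0" using annihilating_poly_exists by blast
  then have "\<exists>g. (g \<noteq> 0 \<and> peval e w g = 0) \<and>
      (\<forall>p. p \<noteq> 0 \<and> peval e w p = 0 \<longrightarrow> degree g \<le> degree p)"
    by (rule ex_has_least_nat)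
  then show ?thesis unfolding minimal_poly_def by blast
qed

definition adjoin :: "'v set" where "adjoin = range (peval e w)"

lemma adjoin_domain: "domain_subalgebra adjoin e"
  unfolding domain_subalgebra_def
proof (intro conjI ballI impI)
  show "subspace adjoin"
  proof (rule subspaceI')
    show "0 \<in> adjoin" unfolding adjoin_def using rangeI[of "peval e w" 0] by simp
  next
    fix x y assume "x \<in> adjoin" "y \<in> adjoin"
    then show "x + y \<in> adjoin" unfolding adjoin_def by (auto simp flip: peval_add)
  next
    fix c x assume "x \<in> adjoin"
    then show "\<phi> c * x \<in> adjoin" unfolding adjoin_def by (auto simp flip: peval_smult)
  qed
  show "e \<in> adjoin" unfolding adjoin_def using rangeI[of "peval e w" 1] by (simp add: peval_1)
  show "e \<noteq> 0" by (rule domain_subalgebraD(3)[OF E])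
  fix x assume x: "x \<in> adjoin"
  then have xE: "x \<in> E" unfolding adjoin_def using peval_in by auto
  then show "e * x = x" "x * e = x" by simp_all
  fix y assume y: "y \<in> adjoin"
  then have yE: "y \<in> E" unfolding adjoin_def using peval_in by auto
  show "x * y \<in> adjoin" using x y unfolding adjoin_def by (auto simp flip: peval_mult)
  assume "x * y = 0"
  then show "x = 0 \<or> y = 0" using domain_subalgebraD(7)[OF E xE yE] by blast
qed

lemma adjoin_commute: "x \<in> adjoin \<Longrightarrow> y \<in> adjoin \<Longrightarrow> x * y = y * x"
  unfolding adjoin_def by (auto simp: mult.commute simp flip: peval_mult)

lemma generator_in_adjoin: "w \<in> adjoin"
  unfolding adjoin_def using rangeI[of "peval e w" "[:0, 1:]"] by (simp add: peval_X)

lemma adjoin_subset: "adjoin \<subseteq> E"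
  unfolding adjoin_def using peval_in by auto

section \<open>Computation modulo a fixed minimal polynomial\<close>

context
  fixes g
  assumes g: "minimal_poly g"
begin

lemma peval_eq_0_iff: "peval e w p = 0 \<longleftrightarrow> g dvd p"
proof
  assume p: "peval e w p = 0"
  have "peval e w (p mod g) = 0"
  proof -
    have "peval e w p = peval e w (g * (p div g) + p mod g)" by simp
    also have "\<dots> = peval e w (p mod g)"
      using g by (simp only: peval_add peval_mult) (simp add: minimal_poly_def)
    finally show ?thesis using p by simp
  qed
  then have "p mod g = 0 \<or> degree g \<le> degree (p mod g)"
    using g by (auto simp: minimal_poly_def)
  then show "g dvd p"
    using degree_mod_less[of g p] g by (auto simp: minimal_poly_def dvd_eq_mod_eq_0)
next
  assume "g dvd p"
  then show "peval e w p = 0"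
    using g by (auto simp: minimal_poly_def peval_mult elim!: dvdE)
qed

lemma peval_eq_iff: "peval e w p = peval e w p' \<longleftrightarrow> p mod g = p' mod g"
proof -
  have "peval e w p = peval e w (p' + (p - p'))" by simp
  also have "\<dots> = peval e w p' + peval e w (p - p')" by (simp only: peval_add)
  finally have "peval e w p = peval e w p' \<longleftrightarrow> peval e w (p - p') = 0" by simp
  then show ?thesis by (simp add: peval_eq_0_iff mod_eq_dvd_iff)
qed

lemma degree_minimal_poly: "degree g > 0"
proof (rule ccontr)
  assume "\<not> degree g > 0"
  then obtain c where "g = [:c:]" by (metis degree_eq_zeroE gr0I)
  then show False using g domain_subalgebraD(3)[OF E] by (auto simp: minimal_poly_def peval_const)
qed

lemma coeff_0_minimal_poly: "w \<noteq> 0 \<Longrightarrow> coeff g 0 \<noteq> 0"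
proof
  assume "w \<noteq> 0" "coeff g 0 = 0"
  obtain a h where h: "g = pCons a h" by (cases g)
  then have "a = 0" using \<open>coeff g 0 = 0\<close> by simp
  then have "w * peval e w h = 0" using g h by (simp add: minimal_poly_def peval_pCons)
  then have "peval e w h = 0"
    using domain_subalgebraD(7)[OF E w peval_in] \<open>w \<noteq> 0\<close> by blast
  moreover have "h \<noteq> 0" using g h \<open>a = 0\<close> by (auto simp: minimal_poly_def)
  ultimately have "degree g \<le> degree h" using g by (auto simp: minimal_poly_def)
  then show False using h \<open>h \<noteq> 0\<close> by simp
qed

text \<open>If \<open>g\<close> does not divide \<open>H\<close>, then \<open>H(w)\<close> is a
  nonzero, hence invertible, element of \<open>F[w]\<close>; a polynomial representing its inverse
  is the Bezout coefficient \<open>v\<close>.\<close>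

lemma minimal_poly_coprime:
  assumes "\<not> g dvd H"
  shows "\<exists>u v. u * g + v * H = 1"
proof -
  have "peval e w H \<noteq> 0" using assms peval_eq_0_iff by blast
  moreover have "peval e w H \<in> adjoin" by (simp add: adjoin_def)
  ultimately obtain y where "y \<in> adjoin" "peval e w H * y = e"
    using domain_subalgebra_inverse[OF adjoin_domain] by metis
  then obtain v where v: "peval e w H * peval e w v = e" by (auto simp: adjoin_def)
  have "peval e w (v * H) = peval e w 1"
    using v by (simp add: peval_1 peval_mult[symmetric] mult.commute)
  then have "g dvd 1 - v * H"
    using peval_eq_iff mod_eq_dvd_iff by metis
  then obtain u where "1 - v * H = g * u" by auto
  then show ?thesis by (intro exI[of _ u] exI[of _ v]) (simp add: algebra_simps)
qed

text \<open>The coefficients of the remainder modulo \<open>g\<close>, which do not depend on the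
  chosen preimage by \<open>peval_eq_iff\<close>.\<close>

definition coord :: "nat \<Rightarrow> 'v \<Rightarrow> 'f" where
  "coord i x = coeff ((SOME p. peval e w p = x) mod g) i"

lemma coord_peval: "coord i (peval e w p) = coeff (p mod g) i"
proof -
  have "peval e w (SOME p'. peval e w p' = peval e w p) = peval e w p"
    by (rule someI[of _ p]) simp
  then show ?thesis unfolding coord_def using peval_eq_iff by metis
qed

lemma coord_power: "k < degree g \<Longrightarrow> coord i (e * w ^ k) = (if i = k then 1 else 0)"
proof -
  assume k: "k < degree g"
  have "e * w ^ k = peval e w (monom 1 k)" by (simp add: peval_monom)
  then have "coord i (e * w ^ k) = coeff (monom 1 k mod g) i" by (simp add: coord_peval)
  also have "monom 1 k mod g = monom 1 k"
    using k by (intro mod_poly_less) (simp add: degree_monom_eq)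
  finally show ?thesis by auto
qed

lemma frame_adjoin: "frame adjoin {..<degree g} (\<lambda>i. e * w ^ i) coord"
  unfolding frame_def
proof (intro conjI ballI)
  fix i assume "i \<in> {..<degree g}"
  have "e * w ^ i = peval e w (monom 1 i)" by (simp add: peval_monom)
  then show "e * w ^ i \<in> adjoin" by (simp add: adjoin_def)
  show "functional_on adjoin (coord i)"
    unfolding functional_on_def adjoin_def
    by (auto simp: coord_peval poly_mod_add_left mod_smult_left simp flip: peval_add peval_smult)
next
  fix x assume "x \<in> adjoin"
  then obtain p where p: "x = peval e w p" by (auto simp: adjoin_def)
  have "degree (p mod g) < degree g"
    using degree_mod_less[of g p] degree_minimal_poly g by (auto simp: minimal_poly_def)
  then obtain d where d: "degree g = Suc d" "degree (p mod g) \<le> d" by (cases "degree g") auto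
  have "x = peval e w (p mod g)" unfolding p peval_eq_iff by simp
  also have "\<dots> = (\<Sum>i\<le>d. \<phi> (coeff (p mod g) i) * (e * w ^ i))"
    by (rule peval_expand[OF d(2)])
  finally have *: "x = (\<Sum>i\<le>d. \<phi> (coeff (p mod g) i) * (e * w ^ i))" .
  have c: "coord i x = coeff (p mod g) i" for i by (simp only: p coord_peval)
  show "x = (\<Sum>i<degree g. \<phi> (coord i x) * (e * w ^ i))"
    unfolding d(1) lessThan_Suc_atMost c by (rule *)
qed simp

text \<open>The trace of the identity, computed in the frame of powers, counts them; a separate
  independence proof is avoided.\<close>

lemma dim_adjoin: "dim adjoin = degree g"
proof -
  note sub = domain_subalgebraD(1)[OF adjoin_domain]
  have "of_nat (dim adjoin) = trace_on adjoin (\<lambda>s. s)" by (simp add: trace_on_id sub)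
  also have "\<dots> = (\<Sum>i<degree g. coord i (e * w ^ i))"
    by (rule trace_on_frame[OF sub frame_adjoin endo_id])
  also have "\<dots> = of_nat (degree g)" by (simp add: coord_power)
  finally show ?thesis by (simp only: of_nat_eq_iff)
qed

text \<open>In the basis \<open>e, w, w^2, ...\<close> multiplication by \<open>x = 1/w\<close>
  shifts every positive power down by one. The only diagonal entry is the constant coefficient of
  \<open>1/w\<close> as a polynomial in \<open>w\<close>, which is
  \<open>- g_1 / g_0\<close>.\<close>

lemma trace_inverse_on_adjoin:
  assumes x: "x \<in> E" "x * w = e" "w * x = e"
  shows "x \<in> adjoin" "trace_on adjoin (\<lambda>s. x * s) * coeff g 0 = - coeff g 1"
proof -
  have "w \<noteq> 0" using x(2) domain_subalgebraD(3)[OF E] by auto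
  then have g0: "coeff g 0 \<noteq> 0" by (rule coeff_0_minimal_poly)
  obtain a h where h: "g = pCons a h" by (cases g)
  then have a: "a \<noteq> 0" using g0 by simp
  \<comment> \<open>Reading \<open>g(w) = 0\<close> as \<open>a e + w h(w) = 0\<close> gives
    \<open>1/w = - h(w) / a\<close>.\<close>
  define p where "p = Polynomial.smult (- inverse a) h"
  have "\<phi> a * e + w * peval e w h = 0"
    using g h by (simp add: minimal_poly_def peval_pCons)
  then have wh: "w * peval e w h = - (\<phi> a * e)" by (simp add: eq_neg_iff_add_eq_0 add.commute)
  have "w * peval e w p = \<phi> (- inverse a) * (w * peval e w h)"
    by (simp only: p_def peval_smult phi_left_commute[of w])
  also have "\<dots> = e" unfolding wh using a by (simp add: phi_minus phi_inverse)
  finally have wp: "w * peval e w p = e" .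
  have "x = x * (w * peval e w p)" using x(1) by (simp add: wp)
  also have "\<dots> = peval e w p" using x peval_in by (simp flip: mult.assoc)
  finally have xp: "x = peval e w p" .
  then show xa: "x \<in> adjoin" by (simp add: adjoin_def)
  have h0: "h \<noteq> 0" using degree_minimal_poly h by auto
  then have "degree p < degree g" using h a by (simp add: p_def)
  then have pm: "p mod g = p" by (rule mod_poly_less)
  note sub = domain_subalgebraD(1)[OF adjoin_domain]
  obtain d where d: "degree g = Suc d" using degree_minimal_poly by (cases "degree g") auto
  have "trace_on adjoin (\<lambda>s. x * s) = (\<Sum>i<degree g. coord i (x * (e * w ^ i)))"
    using domain_subalgebraD(6)[OF adjoin_domain xa]
    by (intro trace_on_frame[OF sub frame_adjoin endo_lmult])
  also have "\<dots> = coord 0 (x * e) + (\<Sum>i<d. coord (Suc i) (x * (e * w ^ Suc i)))"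
    unfolding d sum.lessThan_Suc_shift by simp
  also have "(\<Sum>i<d. coord (Suc i) (x * (e * w ^ Suc i))) = 0"
  proof (rule sum.neutral, rule ballI)
    fix i assume "i \<in> {..<d}"
    have "x * (e * w ^ Suc i) = e * w ^ i"
    proof -
      have "e * w ^ i = peval e w (monom 1 i)" by (simp add: peval_monom)
      then have "e * (e * w ^ i) = e * w ^ i" using peval_in by simp
      then show ?thesis unfolding power_step using x by (simp flip: mult.assoc)
    qed
    then show "coord (Suc i) (x * (e * w ^ Suc i)) = 0"
      using coord_power[of i "Suc i"] d \<open>i \<in> {..<d}\<close> by simp
  qed
  also have "coord 0 (x * e) = coeff p 0"
    using x xp by (simp add: coord_peval pm)
  finally show "trace_on adjoin (\<lambda>s. x * s) * coeff g 0 = - coeff g 1"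
    using a h by (simp add: p_def)
qed

text \<open>\<open>e S\<close> is a sum of \<open>n\<close> copies of \<open>F[w]\<close>. The shape
  matches \<open>ch_functional_inverse\<close>, so that \<open>t\<close> and \<open>T\<close> can be
  compared through the same \<open>g\<close>.\<close>

lemma T_inverse:
  assumes x: "x \<in> E" "x * w = e" "w * x = e"
  shows "\<exists>n. T e = of_nat (n * degree g) \<and> T x * coeff g 0 = - of_nat n * coeff g 1"
proof -
  note F = adjoin_domain
  let ?V = "(\<lambda>s. e * s) ` UNIV"
  have V: "subspace ?V" by (intro subspace_endo_image endo_lmult subspace_UNIV)
  have ee: "e * e = e" using domain_subalgebraD(2)[OF E] by simp
  have TV: "T y = trace_on ?V (\<lambda>s. y * s)" if "y \<in> E" for y
  proof -
    have "y * s = e * (y * s)" for s using that by (simp flip: mult.assoc)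
    then show ?thesis
      unfolding T_def by (intro trace_on_image V subspace_UNIV endo_lmult) auto
  qed
  have act: "y * v \<in> ?V" if "y \<in> adjoin" for y v
  proof -
    have "y * v = e * (y * v)" using domain_subalgebraD(4)[OF F that] by (simp flip: mult.assoc)
    then show ?thesis by blast
  qed
  obtain n where n: "\<And>y. y \<in> adjoin \<Longrightarrow> trace_on ?V (\<lambda>s. y * s) = of_nat n * trace_on adjoin (\<lambda>s. y * s)"
    "dim ?V = n * dim adjoin"
    by (rule trace_on_module[OF F V act]) (auto simp: ee simp flip: mult.assoc)
  have "T e = of_nat (n * degree g)"
    using T_idempotent[OF ee V] n(2) dim_adjoin by simp
  moreover have "T x * coeff g 0 = - of_nat n * coeff g 1"
    using trace_inverse_on_adjoin[OF x] n(1)[of x] TV[OF x(1)] by (simp add: mult.assoc)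
  ultimately show ?thesis by blast
qed

text \<open>Applying \<open>t\<close> to \<open>x ^ k * g(w) = 0\<close> gives a linear recurrence
  for the power sums \<open>t (x ^ k)\<close> with the coefficients of \<open>g\<close>;
  \<open>newton_power_sums\<close> then supplies the exponent \<open>b\<close>.\<close>

lemma ch_functional_inverse:
  assumes x: "x \<in> E" "x * w = e" "w * x = e"
    and t: "functional_on UNIV t" and ch: "ch_at t m x"
  shows "\<exists>b. t e = of_nat (b * degree g) \<and> t x * coeff g 0 = - of_nat b * coeff g 1"
proof -
  define q where "q = degree g"
  have "w \<noteq> 0" using x(2) domain_subalgebraD(3)[OF E] by auto
  then have g0: "coeff g 0 \<noteq> 0" by (rule coeff_0_minimal_poly)
  have cancel: "x ^ (j + i) * (e * w ^ i) = x ^ j * e" for i j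
  proof (induction i)
    case (Suc i)
    have "e * w ^ i = peval e w (monom 1 i)" by (simp add: peval_monom)
    then have eE: "e * (e * w ^ i) = e * w ^ i" using peval_in by simp
    have "x ^ (j + Suc i) * (e * w ^ Suc i) = x ^ (j + i) * (x * (w * (e * w ^ i)))"
      by (simp add: power_step power_commutes[symmetric] mult.assoc del: power_Suc) (simp add: power_Suc2 mult.assoc del: power_Suc)
    also have "x * (w * (e * w ^ i)) = e * w ^ i"
      using x eE by (simp flip: mult.assoc)
    finally show ?case using Suc by simp
  qed simp
  have xe: "x ^ j * e = x ^ j" if "j > 0" for j
    using that x(1) by (cases j) (simp_all add: power_Suc2 mult.assoc del: power_Suc)
  have gx: "(\<Sum>i\<le>q. coeff g i * t (x ^ (k - i) * e)) = 0" if "k \<ge> q" for k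
  proof -
    have "0 = x ^ k * peval e w g" using g by (simp add: minimal_poly_def)
    also have "\<dots> = (\<Sum>i\<le>q. \<phi> (coeff g i) * (x ^ k * (e * w ^ i)))"
      by (subst peval_expand[of g q]) (simp_all add: q_def sum_distrib_left phi_left_commute)
    also have "\<dots> = (\<Sum>i\<le>q. \<phi> (coeff g i) * (x ^ (k - i) * e))"
      using that cancel[of "k - i" i for i] by (intro sum.cong refl) (metis atMost_iff le_add_diff_inverse2 le_trans)
    finally have "t (\<Sum>i\<le>q. \<phi> (coeff g i) * (x ^ (k - i) * e)) = 0"
      using t by (simp add: functional_on_0)
    then show ?thesis by (subst (asm) functional_on_lincomb[OF t subspace_UNIV]) auto
  qed
  \<comment> \<open>For \<open>k = q\<close> the last power would be \<open>x ^ 0 = 1\<close> in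
    place of \<open>e\<close>. That case is kept apart and yields \<open>t e\<close> below.\<close>
  have rec: "(\<Sum>i\<le>q. coeff g i * t (x ^ (k - i))) = 0" if "k > q" for k
    using gx[of k] that by (simp add: xe)
  obtain b where b: "(\<Sum>i<q. coeff g i * t (x ^ (q - i))) = - of_nat (b * q) * coeff g q"
    "coeff g 0 * t (x ^ 1) = - of_nat b * coeff g 1"
    using newton_power_sums[of m "\<lambda>k. t (x ^ k)" g q, OF newton_e_vanishes[OF t ch]
        minimal_poly_coprime q_def[symmetric] _ g0 rec] degree_minimal_poly q_def by auto
  have "(\<Sum>i<q. coeff g i * t (x ^ (q - i) * e)) + coeff g q * t e = 0"
    using gx[of q] by (simp add: lessThan_Suc_atMost[symmetric])
  moreover have "(\<Sum>i<q. coeff g i * t (x ^ (q - i) * e)) = (\<Sum>i<q. coeff g i * t (x ^ (q - i)))"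
    by (intro sum.cong) (auto simp: xe)
  ultimately have "coeff g q * t e = coeff g q * of_nat (b * q)" using b(1) by (simp add: algebra_simps)
  moreover have "coeff g q \<noteq> 0" using g by (simp add: q_def minimal_poly_def)
  ultimately have "t e = of_nat (b * q)" by simp
  then show ?thesis using b(2) by (auto simp: q_def mult.commute)
qed

end

end

end

subsection \<open>Elements of maximal degree\<close>

context fd_central_algebra
begin

text \<open>Polynomial dependence on the parameter, stated without choosing coordinates.\<close>

definition poly_curve :: "('f \<Rightarrow> 'v) \<Rightarrow> bool" where
  "poly_curve u \<longleftrightarrow> (\<forall>\<psi>. functional_on UNIV \<psi> \<longrightarrow> (\<exists>p. \<forall>c. \<psi> (u c) = poly p c))"

lemma poly_curve_const: "poly_curve (\<lambda>c. a)"
  unfolding poly_curve_def by (auto intro: exI[of _ "[:\<psi> a:]" for \<psi>])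

lemma poly_curve_add: "poly_curve u \<Longrightarrow> poly_curve v \<Longrightarrow> poly_curve (\<lambda>c. u c + v c)"
  unfolding poly_curve_def
proof (intro allI impI)
  fix \<psi> assume \<psi>: "functional_on UNIV \<psi>"
    and u: "\<forall>\<psi>. functional_on UNIV \<psi> \<longrightarrow> (\<exists>p. \<forall>c. \<psi> (u c) = poly p c)"
    and v: "\<forall>\<psi>. functional_on UNIV \<psi> \<longrightarrow> (\<exists>p. \<forall>c. \<psi> (v c) = poly p c)"
  obtain p q where "\<forall>c. \<psi> (u c) = poly p c" "\<forall>c. \<psi> (v c) = poly q c"
    using u v \<psi> by blast
  then show "\<exists>p. \<forall>c. \<psi> (u c + v c) = poly p c"
    by (intro exI[of _ "p + q"]) (simp add: functional_on_add[OF \<psi>])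
qed

lemma poly_curve_lmult: "poly_curve u \<Longrightarrow> poly_curve (\<lambda>c. a * u c)"
  unfolding poly_curve_def
proof (intro allI impI)
  fix \<psi> assume \<psi>: "functional_on UNIV \<psi>"
    and u: "\<forall>\<psi>. functional_on UNIV \<psi> \<longrightarrow> (\<exists>p. \<forall>c. \<psi> (u c) = poly p c)"
  have "functional_on UNIV (\<lambda>s. \<psi> (a * s))"
    unfolding functional_on_def
    by (simp add: distrib_left functional_on_add[OF \<psi>] functional_on_scale[OF \<psi>] phi_left_commute[of a])
  then show "\<exists>p. \<forall>c. \<psi> (a * u c) = poly p c" using u by blast
qed

lemma poly_curve_scale: "poly_curve u \<Longrightarrow> poly_curve (\<lambda>c. \<phi> c * u c)"
  unfolding poly_curve_def
proof (intro allI impI)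
  fix \<psi> assume \<psi>: "functional_on UNIV \<psi>"
    and u: "\<forall>\<psi>. functional_on UNIV \<psi> \<longrightarrow> (\<exists>p. \<forall>c. \<psi> (u c) = poly p c)"
  obtain p where "\<forall>c. \<psi> (u c) = poly p c" using u \<psi> by blast
  then show "\<exists>p. \<forall>c. \<psi> (\<phi> c * u c) = poly p c"
    by (intro exI[of _ "[:0, 1:] * p"]) (simp add: functional_on_scale[OF \<psi>])
qed

text \<open>Linear independence is Zariski open: a suitable minor is a nonzero polynomial in the parameter.\<close>
lemma independent_poly_curves:
  fixes n :: nat
  assumes u: "\<And>j. j < n \<Longrightarrow> poly_curve (u j)"
    and inj: "inj_on (\<lambda>j. u j 0) {..<n}" and ind: "independent ((\<lambda>j. u j 0) ` {..<n})"
  shows "\<exists>c. c \<noteq> 0 \<and> (\<forall>a. (\<Sum>j<n. \<phi> (a j) * u j c) = 0 \<longrightarrow> (\<forall>j<n. a j = 0))"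
proof -
  define B where "B = extend_basis ((\<lambda>j. u j 0) ` {..<n})"
  have B: "(\<lambda>j. u j 0) ` {..<n} \<subseteq> B" "independent B" "span B = UNIV"
    unfolding B_def by (rule extend_basis_superset[OF ind] independent_extend_basis[OF ind]
        span_extend_basis[OF ind])+
  \<comment> \<open>Coordinates dual to the starting vectors, so the matrix of the
    \<open>u j c\<close> is the identity at \<open>c = 0\<close>.\<close>
  define \<psi> where "\<psi> i s = representation B s (u i 0)" for i s
  have \<psi>: "functional_on UNIV (\<psi> i)" for i
    unfolding functional_on_def \<psi>_def
    using representation_add[OF B(2)] representation_scale[OF B(2)] B(3) by (auto simp: fscale_def)
  have dual: "\<psi> i (u j 0) = (if i = j then 1 else 0)" if "i < n" "j < n" for i j
  proof -
    have "u j 0 \<in> B" using B(1) that by auto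
    then have "\<psi> i (u j 0) = (if u i 0 = u j 0 then 1 else 0)"
      by (simp add: \<psi>_def representation_basis[OF B(2)])
    then show ?thesis using inj that by (auto simp: inj_on_def)
  qed
  have "\<forall>i j. \<exists>p. j < n \<longrightarrow> (\<forall>c. \<psi> i (u j c) = poly p c)"
    using u \<psi> unfolding poly_curve_def by blast
  then obtain p where p: "\<And>i j c. j < n \<Longrightarrow> \<psi> i (u j c) = poly (p i j) c" by metis
  define M where "M = mat n n (\<lambda>(i, j). p i j)"
  have Mc: "poly (det M) c = det (mat n n (\<lambda>(i, j). \<psi> i (u j c)))" for c
  proof -
    interpret comm_ring_hom "\<lambda>p :: 'f poly. poly p c" by unfold_locales auto
    have "map_mat (\<lambda>p. poly p c) M = mat n n (\<lambda>(i, j). \<psi> i (u j c))"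
      by (rule eq_matI) (auto simp: M_def p)
    then show ?thesis using hom_det[of M] by simp
  qed
  have "mat n n (\<lambda>(i, j). \<psi> i (u j 0)) = 1\<^sub>m n"
    by (rule eq_matI) (auto simp: dual)
  then have "poly (det M) 0 = 1" by (simp add: Mc)
  then have "det M \<noteq> 0" by auto
  then have "finite {c. poly (det M) c = 0}" by (rule poly_roots_finite)
  \<comment> \<open>Zero is excluded along with the roots because the caller needs to divide by
    \<open>c\<close>.\<close>
  then have "finite (insert 0 {c. poly (det M) c = 0})" by simp
  then have "\<exists>c. c \<notin> insert 0 {c. poly (det M) c = 0}"
    by (rule ex_new_if_finite[OF infinite_UNIV_char_0])
  then obtain c where c: "c \<notin> insert 0 {c. poly (det M) c = 0}" by (rule exE)
  have "\<forall>j<n. a j = 0" if a: "(\<Sum>j<n. \<phi> (a j) * u j c) = 0" for a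
  proof (rule ccontr)
    assume "\<not> (\<forall>j<n. a j = 0)"
    then obtain j where j: "j < n" "a j \<noteq> 0" by blast
    let ?A = "mat n n (\<lambda>(i, j). \<psi> i (u j c))"
    have "?A *\<^sub>v vec n a = 0\<^sub>v n"
    proof (rule eq_vecI)
      fix i assume "i < dim_vec (0\<^sub>v n :: 'f vec)"
      then have i: "i < n" by simp
      have "(?A *\<^sub>v vec n a) $ i = (\<Sum>j<n. \<psi> i (u j c) * a j)"
        using i by (simp add: scalar_prod_def lessThan_atLeast0)
      also have "\<dots> = (\<Sum>j<n. a j * \<psi> i (u j c))" by (simp add: mult.commute)
      also have "\<dots> = \<psi> i (\<Sum>j<n. \<phi> (a j) * u j c)"
        by (rule functional_on_lincomb[OF \<psi> subspace_UNIV, symmetric]) simp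
      also have "\<dots> = 0" unfolding a by (rule functional_on_0[OF \<psi> UNIV_I])
      finally show "(?A *\<^sub>v vec n a) $ i = 0\<^sub>v n $ i" using i by simp
    qed simp
    moreover have "vec n a \<noteq> 0\<^sub>v n"
    proof
      assume "vec n a = 0\<^sub>v n"
      then have "vec n a $ j = 0\<^sub>v n $ j" by simp
      then show False using j by simp
    qed
    ultimately have "det ?A = 0"
      by (subst det_0_iff_vec_prod_zero_field[of ?A n]) (auto intro!: exI[of _ "vec n a"])
    then show False using c Mc[of c] by simp
  qed
  then show ?thesis using c by blast
qed

text \<open>If \<open>b\<close> commutes with \<open>y\<close> but lies outside \<open>F[y]\<close>, then so does \<open>g'(y) b\<close>, the derivative at
  \<open>c = 0\<close> of \<open>g(y + c b)\<close>; hence some \<open>y + c b\<close> has larger degree than \<open>y\<close>.\<close>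
lemma self_centralizing_if_max_degree:
  assumes D: "domain_subalgebra D e" and y: "y \<in> D" and g: "minimal_poly e y g"
    and max: "\<And>y' g'. y' \<in> D \<Longrightarrow> minimal_poly e y' g' \<Longrightarrow> degree g' \<le> degree g"
    and b: "b \<in> D" "b * y = y * b"
  shows "b \<in> adjoin e y"
proof (rule ccontr)
  assume nb: "b \<notin> adjoin e y"
  define q where "q = degree g"
  have q: "q > 0" using degree_minimal_poly[OF D y g] by (simp add: q_def)
  note A = adjoin_domain[OF D y]
  have eb: "e * b = b" "b * e = b" using domain_subalgebraD[OF D] b by auto
  have Dy: "y + \<phi> c * b \<in> D" for c
    using domain_subalgebraD(1)[OF D] y b by (intro subspace_add subspace_phi)
  have comm: "b * peval e y p = peval e y p * b" for p
  proof (induction p)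
    case (pCons a p)
    have "b * (y * peval e y p) = (b * y) * peval e y p" by (simp add: mult.assoc)
    also have "\<dots> = y * (peval e y p * b)" using b pCons by (simp add: mult.assoc)
    finally show ?case
      by (simp add: peval_pCons distrib_left distrib_right mult.assoc phi_left_commute[of b] eb)
  qed simp
  \<comment> \<open>\<open>R c\<close> is the difference quotient of \<open>p\<close> at
    \<open>y\<close> in direction \<open>b\<close>; commutation of \<open>b\<close> with
    \<open>y\<close> makes its value at 0 equal to \<open>p'(y) b\<close>.\<close>
  have taylor: "\<exists>R. poly_curve R \<and> R 0 = peval e y (pderiv p) * b \<and>
      (\<forall>c. peval e (y + \<phi> c * b) p = peval e y p + \<phi> c * R c)" for p
  proof (induction p)
    case 0
    then show ?case by (intro exI[of _ "\<lambda>c. 0"]) (simp add: poly_curve_const)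
  next
    case (pCons a p)
    then obtain R where R: "poly_curve R" "R 0 = peval e y (pderiv p) * b"
      "\<And>c. peval e (y + \<phi> c * b) p = peval e y p + \<phi> c * R c" by blast
    define R' where "R' c = b * peval e y p + (y * R c + \<phi> c * (b * R c))" for c
    have "poly_curve R'" unfolding R'_def
      by (intro poly_curve_add poly_curve_const poly_curve_scale poly_curve_lmult R(1))
    moreover have "R' 0 = peval e y (pderiv (pCons a p)) * b"
      by (simp add: R'_def R(2) pderiv_pCons peval_add peval_pCons comm distrib_right mult.assoc)
    moreover have "peval e (y + \<phi> c * b) (pCons a p) = peval e y (pCons a p) + \<phi> c * R' c" for c
      by (simp add: peval_pCons R(3) R'_def distrib_left distrib_right mult.assoc
          phi_left_commute[of y] phi_left_commute[of b] add.assoc)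
    ultimately show ?case by blast
  qed
  obtain R where R: "poly_curve R" "R 0 = peval e y (pderiv g) * b"
    "\<And>c. peval e (y + \<phi> c * b) g = peval e y g + \<phi> c * R c"
    using taylor[of g] by blast
  have z: "R 0 \<notin> adjoin e y"
  proof
    assume zA: "R 0 \<in> adjoin e y"
    have "\<not> g dvd pderiv g" using q by (intro not_dvd_pderiv) (simp add: q_def)
    then have "peval e y (pderiv g) \<noteq> 0" using peval_eq_0_iff[OF D y g] by blast
    moreover have "peval e y (pderiv g) \<in> adjoin e y" by (simp add: adjoin_def[OF D y])
    ultimately obtain i where i: "i \<in> adjoin e y" "i * peval e y (pderiv g) = e"
      using domain_subalgebra_inverse[OF A] by metis
    have "b = i * R 0" using eb by (simp add: R(2) i(2) flip: mult.assoc)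
    then show False using nb domain_subalgebraD(6)[OF A i(1) zA] by simp
  qed
  \<comment> \<open>The \<open>q\<close> powers of \<open>y + c b\<close> together with
    \<open>R c\<close>: independent at \<open>c = 0\<close>, hence also for some nonzero
    \<open>c\<close>.\<close>
  define u where "u j c = (if j < q then e * (y + \<phi> c * b) ^ j else R c)" for j c
  have pc: "poly_curve (\<lambda>c. e * (y + \<phi> c * b) ^ j)" for j
  proof (induction j)
    case (Suc j)
    have "e * (y + \<phi> c * b) ^ Suc j = y * (e * (y + \<phi> c * b) ^ j) + \<phi> c * (b * (e * (y + \<phi> c * b) ^ j))" for c
      unfolding power_step[OF D Dy] by (simp only: distrib_right mult.assoc)
    then show ?case
      using poly_curve_add[OF poly_curve_lmult[OF Suc, of y] poly_curve_scale[OF poly_curve_lmult[OF Suc, of b]]]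
      by simp
  qed (simp add: poly_curve_const)
  let ?P = "(\<lambda>j. e * y ^ j) ` {..<q}"
  note fr = frame_adjoin[OF D y g]
  have PA: "?P \<subseteq> adjoin e y" using frame_in[OF fr] by (auto simp: q_def)
  have sp: "adjoin e y \<subseteq> span ?P"
  proof
    fix x assume "x \<in> adjoin e y"
    from frame_expand[OF fr this] have x: "x = (\<Sum>i<q. fscale \<phi> (coord e y g i x) (e * y ^ i))"
      by (simp add: q_def fscale_def)
    have "(\<Sum>i<q. fscale \<phi> (coord e y g i x) (e * y ^ i)) \<in> span ?P"
      by (intro span_sum span_scale span_base) auto
    then show "x \<in> span ?P" using x by argo
  qed
  have dim: "dim (adjoin e y) = q" using dim_adjoin[OF D y g] by (simp add: q_def)
  have indP: "independent ?P"
    using PA sp dim card_image_le[of "{..<q}" "\<lambda>j. e * y ^ j"]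
    by (intro card_le_dim_spanning[of _ "adjoin e y"]) auto
  have "card ?P = q" using basis_card_eq_dim[OF PA sp indP] dim by simp
  then have injP: "inj_on (\<lambda>j. e * y ^ j) {..<q}" by (intro eq_card_imp_inj_on) auto
  have spA: "span ?P \<subseteq> adjoin e y"
    using PA domain_subalgebraD(1)[OF A] by (rule span_minimal)
  have u0: "(\<lambda>j. u j 0) ` {..<Suc q} = insert (R 0) ?P"
    by (auto simp: u_def lessThan_Suc image_iff)
  have "inj_on (\<lambda>j. u j 0) {..<Suc q}"
  proof -
    have "u j 0 = e * y ^ j" if "j < q" for j using that by (simp add: u_def)
    then have "inj_on (\<lambda>j. u j 0) {..<q}" using injP by (auto simp: inj_on_def)
    moreover have "u q 0 \<notin> (\<lambda>j. u j 0) ` ({..<q} - {q})"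
      using z PA by (auto simp: u_def)
    ultimately show ?thesis by (simp add: lessThan_Suc)
  qed
  moreover have "independent ((\<lambda>j. u j 0) ` {..<Suc q})"
    unfolding u0 using z spA indP by (intro independent_insertI) auto
  moreover have "poly_curve (u j)" for j
    unfolding u_def using pc R(1) by (cases "j < q") simp_all
  ultimately have "\<exists>c. c \<noteq> 0 \<and> (\<forall>a. (\<Sum>j<Suc q. \<phi> (a j) * u j c) = 0 \<longrightarrow> (\<forall>j<Suc q. a j = 0))"
    by (intro independent_poly_curves)
  then obtain c where c: "c \<noteq> 0 \<and> (\<forall>a. (\<Sum>j<Suc q. \<phi> (a j) * u j c) = 0 \<longrightarrow> (\<forall>j<Suc q. a j = 0))"
    by (rule exE)
  define y' where "y' = y + \<phi> c * b"
  have y': "y' \<in> D" using Dy by (simp add: y'_def)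
  obtain g' where g': "minimal_poly e y' g'" using minimal_poly_exists[OF D y'] by blast
  then have dg': "degree g' \<le> q" using max[OF y'] by (simp add: q_def)
  have gq: "coeff g q \<noteq> 0" using q by (auto simp: q_def)
  define \<alpha> where "\<alpha> = coeff g' q / coeff g q"
  define r where "r = g' - Polynomial.smult \<alpha> g"
  have rq: "coeff r q = 0" using gq by (simp add: r_def \<alpha>_def)
  have dr: "degree r \<le> q" using dg' by (auto simp: r_def q_def intro!: degree_diff_le)
  have "peval e y' g' = 0" using g' by (simp add: minimal_poly_def[OF D y'])
  then have "peval e y' (r + Polynomial.smult \<alpha> g) = 0" by (simp add: r_def)
  then have "peval e y' r + \<phi> \<alpha> * peval e y' g = 0" by (simp only: peval_add peval_smult)
  moreover have "peval e y' g = \<phi> c * R c"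
    using R(3)[of c] g by (simp add: y'_def minimal_poly_def[OF D y])
  moreover have "peval e y' r = (\<Sum>j<q. \<phi> (coeff r j) * (e * y' ^ j))"
    unfolding peval_expand[OF D y' dr] lessThan_Suc_atMost[symmetric] using rq by simp
  ultimately have "(\<Sum>j<Suc q. \<phi> (if j < q then coeff r j else \<alpha> * c) * u j c) = 0"
    by (simp add: u_def y'_def phi_mult mult.assoc)
  then have *: "\<forall>j<Suc q. (if j < q then coeff r j else \<alpha> * c) = 0"
    by (rule c[THEN conjunct2, THEN spec, THEN mp])
  then have "\<alpha> = 0" using c[THEN conjunct1] by (auto dest: spec[of _ q])
  moreover have "r = 0"
  proof (rule poly_eqI)
    fix j show "coeff r j = coeff 0 j"
      using * rq dr by (cases j q rule: linorder_cases) (auto simp: coeff_eq_0 dest: spec[of _ j])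
  qed
  ultimately have "g' = 0" by (simp add: r_def)
  then show False using g' by (simp add: minimal_poly_def[OF D y'])
qed

end

subsection \<open>The reduced degree\<close>

context prime_fd_algebra
begin

lemma dim_UNIV_pos: "dim UNIV > 0"
proof (rule ccontr)
  assume "\<not> dim UNIV > 0"
  then have "dim UNIV = 0" by simp
  then have "(UNIV :: 'v set) \<subseteq> {0}" by (simp only: dim_eq_0)
  then have "(1 :: 'v) \<in> {0}" by blast
  then show False by simp
qed

lemma center_nondegenerate:
  assumes "d \<in> ring_center" "\<And>z. z \<in> ring_center \<Longrightarrow> T (d * z) = 0"
  shows "d = 0"
proof (rule ccontr)
  assume "d \<noteq> 0"
  then obtain z where "z \<in> ring_center" "d * z = 1"
    using domain_subalgebra_inverse[OF center_domain assms(1)] by metis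
  then have "T 1 = 0" using assms(2)[of z] by simp
  then show False using dim_UNIV_pos unfolding T_1 by (simp only: of_nat_eq_0_iff less_irrefl)
qed

lemma phi_in_center: "\<phi> c \<in> ring_center"
  unfolding ring_center_def using phi_central by blast

lemma center_diff: "(x::'v) \<in> ring_center \<Longrightarrow> y \<in> ring_center \<Longrightarrow> x - y \<in> ring_center"
  by (rule subspace_diff[OF domain_subalgebraD(1)[OF center_domain]])

text \<open>The form stays nondegenerate on the centre, so a central element can be identified by
  testing against central elements only.\<close>

lemma center_eq_scalar:
  assumes c: "c \<in> ring_center" and eq: "\<And>z. z \<in> ring_center \<Longrightarrow> v * T (c * z) = u * T z"
  shows "\<phi> v * c = \<phi> u"
proof -
  have "\<phi> v * c - \<phi> u = 0"
  proof (rule center_nondegenerate)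
    show "\<phi> v * c - \<phi> u \<in> ring_center"
      by (intro center_diff domain_subalgebraD(6)[OF center_domain] phi_in_center c)
    show "T ((\<phi> v * c - \<phi> u) * z) = 0" if "z \<in> ring_center" for z
      using eq[OF that] by (simp add: left_diff_distrib T_diff mult.assoc T_scale)
  qed
  then show ?thesis by simp
qed

text \<open>For central \<open>z\<close> both \<open>t z\<close> and \<open>T z\<close> are fixed
  multiples of \<open>g_1 / g_0\<close>, with \<open>g\<close> the minimal polynomial of
  \<open>1/z\<close>, and the multipliers are in the ratio \<open>t 1 : T 1\<close>. This determines
  the central \<open>c\<close> with \<open>t x = T (c * x)\<close>, hence \<open>t\<close>
  everywhere.\<close>

lemma ch_trace_proportional:
  assumes t: "functional_on UNIV t" and sym: "\<And>x y. t (x * y) = t (y * x)"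
    and t1: "t 1 = of_nat m" and ch: "\<And>x. ch_at t m x"
  shows "of_nat (dim UNIV) * t x = of_nat m * T x"
proof -
  obtain c where c: "c \<in> ring_center" "\<And>x. t x = T (c * x)"
    using symmetric_functional[OF t sym] by blast
  have "of_nat (dim UNIV) * t z = of_nat m * T z" if z: "z \<in> ring_center" for z
  proof (cases "z = 0")
    case True
    then show ?thesis using functional_on_0[OF t] by simp
  next
    case False
    note Z = center_domain
    obtain w where w: "w \<in> ring_center" "z * w = 1" "w * z = 1"
      by (rule domain_subalgebra_inverse[OF Z z False])
    obtain g where g: "minimal_poly 1 w g" using minimal_poly_exists[OF Z w(1)] by blast
    obtain b where b: "t 1 = of_nat (b * degree g)" "t z * coeff g 0 = - of_nat b * coeff g 1"
      using ch_functional_inverse[OF Z w(1) g z w(2,3) t ch] by blast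
    obtain n where n: "T 1 = of_nat (n * degree g)" "T z * coeff g 0 = - of_nat n * coeff g 1"
      using T_inverse[OF Z w(1) g z w(2,3)] by blast
    have "w \<noteq> 0" using w(2) by auto
    then have g0: "coeff g 0 \<noteq> 0" by (rule coeff_0_minimal_poly[OF Z w(1) g])
    have "(of_nat (dim UNIV) * t z) * coeff g 0 = T 1 * (t z * coeff g 0)"
      unfolding T_1 by (simp only: mult.assoc)
    also have "\<dots> = t 1 * (T z * coeff g 0)"
      unfolding b n by (simp add: algebra_simps)
    also have "\<dots> = (of_nat m * T z) * coeff g 0" by (simp add: t1 mult.assoc)
    finally show ?thesis using g0 by simp
  qed
  then have "\<phi> (of_nat (dim UNIV)) * c = \<phi> (of_nat m)"
    using c by (intro center_eq_scalar) auto
  then have "T (\<phi> (of_nat (dim UNIV)) * c * x) = T (\<phi> (of_nat m) * x)" by simp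
  then show ?thesis unfolding mult.assoc T_scale c(2) .
qed

text \<open>The right regular trace is symmetric and agrees with \<open>T\<close> on the centre,
  which forces its representing element to be 1.\<close>

lemma trace_rmult: "trace_on UNIV (\<lambda>x. x * s) = T s"
proof -
  define t where "t s = trace_on UNIV (\<lambda>x. x * s)" for s
  have t: "functional_on UNIV t"
    unfolding functional_on_def t_def
    using trace_on_add[OF subspace_UNIV endo_rmult endo_rmult]
      trace_on_scale[OF subspace_UNIV endo_rmult]
    by (simp add: distrib_left phi_left_commute)
  have sym: "t (x * y) = t (y * x)" for x y
    using trace_cyclic[OF endo_rmult[of x] endo_rmult[of y]] by (simp add: t_def mult.assoc)
  obtain c where c: "c \<in> ring_center" "\<And>x. t x = T (c * x)"
    using symmetric_functional[OF t sym] by blast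
  have "\<phi> 1 * c = \<phi> 1"
  proof (rule center_eq_scalar[OF c(1)])
    fix z :: 'v assume z: "z \<in> ring_center"
    have "t z = T z" unfolding t_def T_def center_commute[OF z] ..
    then show "1 * T (c * z) = 1 * T z" using c(2)[of z] by simp
  qed
  then show ?thesis using c(2)[of s] by (simp add: t_def)
qed

text \<open>For fixed \<open>s\<close> the functional is symmetric, since left and right
  multiplications commute and the trace is cyclic. Classically \<open>C s\<close> is the reduced
  trace of \<open>s\<close> over the centre divided by the reduced degree.\<close>

lemma trace_lrmult:
  "\<exists>C. \<forall>s. C s \<in> ring_center \<and> (\<forall>a. trace_on UNIV (\<lambda>x. a * x * s) = T (C s * a))"
proof -
  have "\<exists>c. c \<in> ring_center \<and> (\<forall>a. trace_on UNIV (\<lambda>x. a * x * s) = T (c * a))" for s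
  proof -
    define t where "t a = trace_on UNIV (\<lambda>x. a * x * s)" for a
    have t: "functional_on UNIV t"
      unfolding functional_on_def t_def
      using trace_on_add[OF subspace_UNIV endo_lrmult[of _ s] endo_lrmult[of _ s]]
        trace_on_scale[OF subspace_UNIV endo_lrmult[of _ s]]
      by (simp add: distrib_right mult.assoc)
    have sym: "t (x * y) = t (y * x)" for x y
      using trace_cyclic[OF endo_lmult[of x] endo_lrmult[of y s]] by (simp add: t_def mult.assoc)
    obtain c where "c \<in> ring_center" "\<And>x. t x = T (c * x)"
      using symmetric_functional[OF t sym] by blast
    then show ?thesis by (auto simp: t_def)
  qed
  then show ?thesis by metis
qed

text \<open>\<open>S\<close> and \<open>e S\<close> are both sums of copies of the centre, so the
  traces of \<open>z\<close> on them are in the ratio of the dimensions.\<close>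

lemma T_center_idempotent:
  assumes e: "e * e = e" and z: "z \<in> ring_center"
  shows "of_nat (dim UNIV) * T (z * e) = T e * T z"
proof -
  let ?V = "(\<lambda>s. e * s) ` UNIV"
  note Z = center_domain
  have V: "subspace ?V" by (intro subspace_endo_image endo_lmult subspace_UNIV)
  have act: "x * v \<in> ?V" if x: "x \<in> ring_center" and "v \<in> ?V" for x v
  proof -
    from \<open>v \<in> ?V\<close> obtain s where "v = e * s" by blast
    then have "x * v = e * (x * s)" using center_commute[OF x, of e] by (simp flip: mult.assoc)
    then show ?thesis by blast
  qed
  obtain n where n: "\<And>x. x \<in> ring_center \<Longrightarrow>
      trace_on ?V (\<lambda>s. x * s) = of_nat n * trace_on ring_center (\<lambda>s. x * s)"
    "dim ?V = n * dim ring_center"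
    by (rule trace_on_module[OF Z V act]) auto
  obtain k where k: "\<And>x. x \<in> ring_center \<Longrightarrow>
      trace_on UNIV (\<lambda>s. x * s) = of_nat k * trace_on ring_center (\<lambda>s. x * s)"
    "dim UNIV = k * dim ring_center"
    by (rule trace_on_module[OF Z subspace_UNIV]) auto
  have ze: "z * e * s = e * (z * s)" for s
    using center_commute[OF z, of e] by (simp flip: mult.assoc)
  have "T (z * e) = trace_on ?V (\<lambda>s. z * e * s)"
    unfolding T_def by (intro trace_on_image V subspace_UNIV endo_lmult) (auto simp: ze)
  also have "\<dots> = trace_on ?V (\<lambda>s. z * s)"
  proof (rule trace_on_cong[OF V endo_lmult endo_lmult])
    fix x assume "x \<in> ?V"
    then obtain s where s: "x = e * s" by blast
    have "z * e * x = z * (e * e * s)" by (simp add: s mult.assoc)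
    then show "z * e * x = z * x" by (simp add: s e)
    show "z * e * x \<in> ?V" unfolding ze by blast
  qed
  finally have "T (z * e) = of_nat n * trace_on ring_center (\<lambda>s. z * s)" using n(1)[OF z] by simp
  moreover have "T z = of_nat k * trace_on ring_center (\<lambda>s. z * s)" using k(1)[OF z] by (simp add: T_def)
  moreover have "T e = of_nat (n * dim ring_center)" using T_idempotent[OF e V] n(2) by simp
  ultimately show ?thesis unfolding k(2) by simp
qed

text \<open>\<open>E\<close> is a maximal subfield of the division algebra \<open>e S e\<close>. For \<open>T\<close>-dual bases \<open>b\<close>, \<open>a b\<close> of \<open>E\<close>,
  the operator \<open>P s = \<Sum> a b * s * b\<close> maps \<open>S\<close> into the centralizer \<open>E\<close> and is \<open>1/n\<close> on \<open>E\<close>; comparing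
  this with \<open>tr (L a R b) = T (C b * a)\<close>, where \<open>C b\<close> is central, yields \<open>dim S = n^2 dim Z\<close>.\<close>
lemma reduced_degree_exists:
  obtains e y g n where "domain_subalgebra {e * s * e |s. True} e" "y \<in> {e * s * e |s. True}" "y \<noteq> 0"
    "minimal_poly e y g" "T e = of_nat (n * degree g)" "n > 0" "dim UNIV = n\<^sup>2 * dim ring_center"
proof -
  have "right_ideal UNIV" by (simp add: right_ideal_def)
  then obtain e where "e \<in> UNIV" and e: "e * e = e" "domain_subalgebra {e * s * e |s. True} e"
    by (rule primitive_idempotent_exists[OF _ UNIV_I one_neq_zero])
  define D where "D = {e * s * e |s. True}"
  have D: "domain_subalgebra D e" unfolding D_def by (rule e(2))
  note D' = domain_subalgebraD[OF D]
  have e0: "e \<noteq> 0" by (rule D'(3))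
  \<comment> \<open>Zero is excluded because \<open>y\<close> is inverted later; the case
    \<open>y' = 0\<close> of \<open>max\<close> is recovered from degree 1.\<close>
  define Q where "Q = (\<lambda>(y, g). y \<in> D \<and> y \<noteq> 0 \<and> minimal_poly e y g)"
  obtain g0 where "minimal_poly e e g0" using minimal_poly_exists[OF D D'(2)] by blast
  then have "Q (e, g0)" using D'(2,3) by (simp add: Q_def)
  moreover have "\<forall>p. Q p \<longrightarrow> degree (snd p) < Suc (dim UNIV)"
  proof (intro allI impI)
    fix p assume "Q p"
    then have p: "fst p \<in> D" "minimal_poly e (fst p) (snd p)" by (auto simp: Q_def split: prod.splits)
    show "degree (snd p) < Suc (dim UNIV)"
      unfolding dim_adjoin[OF D p, symmetric] less_Suc_eq_le by (rule dim_subset[OF subset_UNIV])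
  qed
  ultimately have "\<exists>p. Q p \<and> (\<forall>p'. Q p' \<longrightarrow> degree (snd p') \<le> degree (snd p))"
    by (rule ex_has_greatest_nat)
  then obtain y g where yg: "y \<in> D" "y \<noteq> 0" "minimal_poly e y g"
    and max0: "\<forall>p'. Q p' \<longrightarrow> degree (snd p') \<le> degree g"
    by (auto simp: Q_def)
  have max: "degree g' \<le> degree g" if y': "y' \<in> D" and g': "minimal_poly e y' g'" for y' g'
  proof (cases "y' = 0")
    case True
    have "peval e y' [:0, 1:] = 0" using peval_X[OF D y'] True by simp
    then have "degree g' \<le> degree [:0, 1 :: 'f:]"
      using g'[unfolded minimal_poly_def[OF D y'], THEN conjunct2, THEN conjunct2, THEN spec, of "[:0, 1:]"]
      by simp
    then show ?thesis using degree_minimal_poly[OF D yg(1,3)] by simp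
  next
    case False
    then have "Q (y', g')" using y' g' by (simp add: Q_def)
    then show ?thesis using max0[rule_format, of "(y', g')"] by simp
  qed
  define q where "q = degree g"
  define E where "E = adjoin e y"
  have E: "domain_subalgebra E e" unfolding E_def by (rule adjoin_domain[OF D yg(1)])
  note E' = domain_subalgebraD[OF E]
  have ED: "E \<subseteq> D" unfolding E_def by (rule adjoin_subset[OF D yg(1)])
  have yE: "y \<in> E" unfolding E_def by (rule generator_in_adjoin[OF D yg(1)])
  have Ecomm: "x * x' = x' * x" if "x \<in> E" "x' \<in> E" for x x'
    using adjoin_commute[OF D yg(1)] that unfolding E_def .
  have dimE: "dim E = q" unfolding E_def q_def by (rule dim_adjoin[OF D yg(1,3)])
  have q0: "q > 0" unfolding q_def by (rule degree_minimal_poly[OF D yg(1,3)])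
  have cent: "x \<in> E" if "x \<in> D" "x * y = y * x" for x
    unfolding E_def using self_centralizing_if_max_degree[OF D yg(1,3) max that] .
  let ?V = "(\<lambda>s. e * s) ` UNIV"
  have V: "subspace ?V" by (intro subspace_endo_image endo_lmult subspace_UNIV)
  have xe: "x * s = e * (x * s)" if "x \<in> E" for x s using E'(4)[OF that] by (simp flip: mult.assoc)
  have act: "x * v \<in> ?V" if "x \<in> E" for x v
    using rangeI[of "\<lambda>s. e * s" "x * v"] xe[OF that, of v] by simp
  obtain n where n: "\<And>x. x \<in> E \<Longrightarrow> trace_on ?V (\<lambda>s. x * s) = of_nat n * trace_on E (\<lambda>s. x * s)"
    "dim ?V = n * dim E"
    by (rule trace_on_module[OF E V act]) (auto simp: e(1) simp flip: mult.assoc)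
  have TE: "T x = of_nat n * trace_on E (\<lambda>s. x * s)" if "x \<in> E" for x
  proof -
    have "T x = trace_on ?V (\<lambda>s. x * s)"
      unfolding T_def using act[OF that] by (intro trace_on_image V subspace_UNIV endo_lmult) auto
    then show ?thesis using n(1)[OF that] by simp
  qed
  have Te: "T e = of_nat (n * q)" using T_idempotent[OF e(1) V] n(2) dimE by simp
  have n0: "n > 0"
  proof (rule ccontr)
    assume "\<not> n > 0"
    then have "dim ?V = 0" using n(2) by simp
    then have "?V \<subseteq> {0}" by (simp only: dim_eq_0)
    then have "e * 1 \<in> {0}" by blast
    then show False using e0 by simp
  qed
  have nondeg: "a = 0" if a: "a \<in> E" and 0: "\<And>x. x \<in> E \<Longrightarrow> T (a * x) = 0" for a
  proof (rule ccontr)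
    assume "a \<noteq> 0"
    then obtain x where "x \<in> E" "a * x = e" by (rule domain_subalgebra_inverse[OF E a])
    then have "T e = 0" using 0[of x] by simp
    then show False using Te n0 q0 by simp
  qed
  obtain B f where fr: "frame E B (\<lambda>b. b) f" by (rule obtain_frame[OF E'(1)])
  have BE: "b \<in> E" if "b \<in> B" for b using frame_in[OF fr that] .
  have "\<forall>b\<in>B. \<exists>a\<in>E. \<forall>x\<in>E. T (a * x) = f b x"
    using riesz[OF E'(1) functional_T nondeg frame_functional[OF fr]] by blast
  \<comment> \<open>The \<open>T\<close>-dual family: the coordinate functions of \<open>E\<close>
    are the functionals \<open>T (a b * _)\<close>.\<close>
  then obtain a where a: "\<And>b. b \<in> B \<Longrightarrow> a b \<in> E" "\<And>b x. b \<in> B \<Longrightarrow> x \<in> E \<Longrightarrow> T (a b * x) = f b x"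
    by metis
  have Tmult: "functional_on UNIV (\<lambda>s. T (s * x))" for x
    unfolding functional_on_def by (simp add: distrib_right mult.assoc T_add T_scale)
  have dual: "x = (\<Sum>b\<in>B. \<phi> (T (b * x)) * a b)" if x: "x \<in> E" for x
  proof -
    have "x - (\<Sum>b\<in>B. \<phi> (T (b * x)) * a b) = 0"
    proof (rule nondeg)
      show "x - (\<Sum>b\<in>B. \<phi> (T (b * x)) * a b) \<in> E"
        using E'(1) x a by (intro subspace_diff subspace_sum subspace_phi)
      fix s assume s: "s \<in> E"
      have "T ((\<Sum>b\<in>B. \<phi> (T (b * x)) * a b) * s) = (\<Sum>b\<in>B. T (b * x) * T (a b * s))"
        by (simp add: sum_distrib_right T_sum mult.assoc T_scale)
      also have "\<dots> = (\<Sum>b\<in>B. f b s * T (b * x))"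
        using a(2) s by (intro sum.cong) auto
      also have "\<dots> = T (s * x)"
        using functional_expand[OF fr Tmult subspace_UNIV subset_UNIV s, of x] by simp
      also have "\<dots> = T (x * s)" by (rule T_commute)
      finally show "T ((x - (\<Sum>b\<in>B. \<phi> (T (b * x)) * a b)) * s) = 0"
        by (simp add: left_diff_distrib T_diff)
    qed
    then show ?thesis by simp
  qed
  define P where "P s = (\<Sum>b\<in>B. a b * s * b)" for s
  have endoP: "endo P" unfolding P_def by (intro endo_lincomb endo_lrmult)
  \<comment> \<open>The Casimir argument: expanding \<open>x * a b\<close> in the \<open>a c\<close>
    moves the factor \<open>x\<close> to the other side of the sum.\<close>
  have comm: "x * P s = P s * x" if x: "x \<in> E" for x s
  proof -
    have "x * P s = (\<Sum>b\<in>B. (x * a b) * s * b)"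
      by (simp add: P_def sum_distrib_left mult.assoc)
    also have "\<dots> = (\<Sum>b\<in>B. \<Sum>c\<in>B. a c * s * (\<phi> (T (c * (x * a b))) * b))"
    proof (rule sum.cong[OF refl])
      fix b assume b: "b \<in> B"
      have "(x * a b) * s * b = (\<Sum>c\<in>B. \<phi> (T (c * (x * a b))) * a c) * s * b"
        using arg_cong[OF dual[OF E'(6)[OF x a(1)[OF b]]], of "\<lambda>r. r * s * b"] .
      also have "\<dots> = (\<Sum>c\<in>B. a c * s * (\<phi> (T (c * (x * a b))) * b))"
        unfolding sum_distrib_right by (rule sum.cong[OF refl]) (metis mult.assoc phi_central)
      finally show "(x * a b) * s * b = \<dots>" .
    qed
    also have "\<dots> = (\<Sum>c\<in>B. \<Sum>b\<in>B. a c * s * (\<phi> (T (c * (x * a b))) * b))"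
      by (rule sum.swap)
    also have "\<dots> = (\<Sum>c\<in>B. a c * s * (\<Sum>b\<in>B. \<phi> (f b (c * x)) * b))"
    proof (rule sum.cong[OF refl])
      fix c assume c: "c \<in> B"
      have "T (c * (x * a b)) = f b (c * x)" if b: "b \<in> B" for b
        using a(2)[OF b E'(6)[OF BE[OF c] x]] T_commute[of "c * x" "a b"] by (simp add: mult.assoc)
      then show "(\<Sum>b\<in>B. a c * s * (\<phi> (T (c * (x * a b))) * b)) =
          a c * s * (\<Sum>b\<in>B. \<phi> (f b (c * x)) * b)"
        by (simp add: sum_distrib_left)
    qed
    also have "\<dots> = (\<Sum>c\<in>B. a c * s * (c * x))"
      using frame_expand[OF fr E'(6)[OF BE x]] by (intro sum.cong refl arg_cong[of _ _ "\<lambda>r. _ * r"]) (simp only:)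
    also have "\<dots> = P s * x" by (simp add: P_def sum_distrib_right mult.assoc)
    finally show ?thesis .
  qed
  have PE: "P s \<in> E" for s
  proof (rule cent)
    have "e * P s = P s" "P s * e = P s"
      unfolding P_def sum_distrib_left sum_distrib_right
      using E'(4)[OF a(1)] E'(5)[OF BE] by (auto intro!: sum.cong simp flip: mult.assoc) (simp add: mult.assoc)
    then have "P s = e * P s * e" by simp
    then show "P s \<in> D" unfolding D_def by blast
    show "P s * y = y * P s" using comm[OF yE] by simp
  qed
  define u where "u = (\<Sum>b\<in>B. a b * b)"
  have uE: "u \<in> E" unfolding u_def using E' a(1) BE by (intro subspace_sum) auto
  have trE: "trace_on E (\<lambda>s. x * s) = (\<Sum>b\<in>B. f b (x * b))" if "x \<in> E" for x
    using E'(6)[OF that] by (intro trace_on_frame[OF E'(1) fr endo_lmult])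
  \<comment> \<open>\<open>T (u x)\<close> is the field trace of \<open>x\<close> on
    \<open>E\<close>, of which \<open>T x\<close> is \<open>n\<close> times.\<close>
  have nu: "\<phi> (of_nat n) * u = e"
  proof -
    have "\<phi> (of_nat n) * u - e = 0"
    proof (rule nondeg)
      show "\<phi> (of_nat n) * u - e \<in> E" using E' uE by (intro subspace_diff subspace_phi)
      fix x assume x: "x \<in> E"
      have "T (u * x) = (\<Sum>b\<in>B. T (a b * (b * x)))"
        by (simp add: u_def sum_distrib_right T_sum mult.assoc)
      also have "\<dots> = (\<Sum>b\<in>B. f b (x * b))"
        using a(2) E'(6) BE Ecomm x by (intro sum.cong) auto
      finally have "of_nat n * T (u * x) = T x" using TE[OF x] trE[OF x] by simp
      then show "T ((\<phi> (of_nat n) * u - e) * x) = 0"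
        using E'(4)[OF x] by (simp add: left_diff_distrib T_diff mult.assoc T_scale)
    qed
    then show ?thesis by simp
  qed
  have trP: "of_nat n * trace_on UNIV P = of_nat q"
  proof -
    have "trace_on UNIV P = trace_on E P"
      using PE by (intro trace_on_image E'(1) subspace_UNIV endoP) auto
    also have "\<dots> = trace_on E (\<lambda>s. u * s)"
    proof (rule trace_on_cong[OF E'(1) endoP endo_lmult PE])
      fix x assume x: "x \<in> E"
      have "a b * x * b = a b * b * x" if "b \<in> B" for b
        using Ecomm[OF x BE[OF that]] by (simp add: mult.assoc)
      then show "P x = u * x" by (simp add: P_def u_def sum_distrib_right)
    qed
    finally have "of_nat n * trace_on UNIV P = trace_on E (\<lambda>s. \<phi> (of_nat n) * (u * s))"
      using trace_on_scale[OF E'(1) endo_lmult E'(6)[OF uE]] by simp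
    also have "\<dots> = trace_on E (\<lambda>s. e * s)" by (simp add: nu flip: mult.assoc)
    also have "\<dots> = trace_on E (\<lambda>s. s)"
      using E' by (intro trace_on_cong endo_lmult endo_id) auto
    finally show ?thesis using E'(1) dimE by (simp add: trace_on_id)
  qed
  obtain C where C0: "\<forall>s. C s \<in> ring_center \<and> (\<forall>a. trace_on UNIV (\<lambda>x. a * x * s) = T (C s * a))"
    using trace_lrmult by (rule exE)
  have C: "C s \<in> ring_center" "trace_on UNIV (\<lambda>r. x * r * s) = T (C s * x)" for s x
    by (rule C0[THEN spec, THEN conjunct1], rule C0[THEN spec, THEN conjunct2, THEN spec])
  have Ceq: "C s = c" if "\<And>x. trace_on UNIV (\<lambda>r. x * r * s) = T (c * x)" for s c
  proof -
    have "T ((C s - c) * x) = 0" for x using C(2)[of x s] that[of x] by (simp add: left_diff_distrib T_diff)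
    then have "C s - c = 0" by (rule T_nondegenerate)
    then show ?thesis by simp
  qed
  \<comment> \<open>\<open>M\<close> carries the second computation of the trace of
    \<open>P\<close>: its image lies in \<open>Z e\<close>, where it is the scalar
    \<open>n q / N\<close>.\<close>
  define M where "M s = C s * e" for s
  have endoM: "endo M"
  proof -
    have "C (s + s') = C s + C s'" for s s'
    proof (rule Ceq)
      fix x
      show "trace_on UNIV (\<lambda>r. x * r * (s + s')) = T ((C s + C s') * x)"
        using trace_on_add[OF subspace_UNIV endo_lrmult[of x s] endo_lrmult[of x s']] C(2)
        by (simp add: distrib_left distrib_right T_add)
    qed
    moreover have "C (\<phi> c * s) = \<phi> c * C s" for c s
    proof (rule Ceq)
      fix x
      have "trace_on UNIV (\<lambda>r. x * r * (\<phi> c * s)) = c * trace_on UNIV (\<lambda>r. x * r * s)"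
        unfolding phi_left_commute by (rule trace_on_scale[OF subspace_UNIV endo_lrmult UNIV_I])
      then show "trace_on UNIV (\<lambda>r. x * r * (\<phi> c * s)) = T (\<phi> c * C s * x)"
        unfolding C(2) by (simp only: mult.assoc T_scale)
    qed
    ultimately show ?thesis unfolding endo_def M_def by (simp add: distrib_right mult.assoc)
  qed
  have CZ: "C (z * e) = z * C e" if z: "z \<in> ring_center" for z
  proof (rule Ceq)
    fix x
    have "x * r * (z * e) = (x * z) * r * e" for r
    proof -
      have "x * r * (z * e) = x * (r * z) * e" by (simp only: mult.assoc)
      also have "\<dots> = (x * z) * r * e" by (simp only: center_commute[OF z, of r, symmetric] mult.assoc)
      finally show ?thesis .
    qed
    then have "trace_on UNIV (\<lambda>r. x * r * (z * e)) = T (C e * (x * z))" using C(2) by simp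
    also have "C e * (x * z) = z * C e * x"
      using center_commute[OF z, of "C e * x"] by (simp add: mult.assoc)
    finally show "trace_on UNIV (\<lambda>r. x * r * (z * e)) = T (z * C e * x)" .
  qed
  define N where "N = dim UNIV"
  \<comment> \<open>For central \<open>z\<close>, the map \<open>r -> z r e\<close> is right
    multiplication by \<open>z e\<close>, so its trace is \<open>T (z e)\<close>.\<close>
  have Ce: "\<phi> (of_nat N) * C e = \<phi> (of_nat (n * q))"
  proof (rule center_eq_scalar[OF C(1)])
    fix z :: 'v assume z: "z \<in> ring_center"
    have "z * r * e = r * (z * e)" for r using center_commute[OF z, of r] by (simp add: mult.assoc)
    then have "T (C e * z) = T (z * e)" using C(2)[of z e] trace_rmult[of "z * e"] by simp
    then show "of_nat N * T (C e * z) = of_nat (n * q) * T z"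
      using T_center_idempotent[OF e(1) z] Te by (simp only: N_def)
  qed
  let ?Ze = "(\<lambda>z. z * e) ` ring_center"
  note Z = domain_subalgebraD[OF center_domain]
  have Ze: "subspace ?Ze" by (intro subspace_endo_image endo_rmult Z(1))
  have ZeE: "?Ze \<subseteq> E"
  proof
    fix x assume "x \<in> ?Ze"
    then obtain z where z: "z \<in> ring_center" and x: "x = z * e" by blast
    show "x \<in> E"
    proof (rule cent)
      have "e * z * e = z * (e * e)" by (simp only: center_commute[OF z, of e, symmetric] mult.assoc)
      then have "x = e * z * e" by (simp only: x e(1))
      then show "x \<in> D" unfolding D_def by blast
      show "x * y = y * x"
        using center_commute[OF z, of y] D'(4,5)[OF yg(1)] by (metis x mult.assoc)
    qed
  qed
  have dimZe: "dim ?Ze = dim ring_center"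
  proof (rule dim_image_eq[OF endo_rmult Z(1)])
    fix z :: 'v assume z: "z \<in> ring_center" "z * e = 0"
    show "z = 0"
    proof (rule ccontr)
      assume "z \<noteq> 0"
      then obtain w where "w * z = 1" by (rule domain_subalgebra_inverse[OF center_domain z(1)])
      then have "e = w * (z * e)" by (simp flip: mult.assoc)
      then show False using z(2) e0 by simp
    qed
  qed
  have "trace_on UNIV P = (\<Sum>b\<in>B. trace_on UNIV (\<lambda>s. a b * s * b))"
    unfolding P_def by (intro trace_on_sum subspace_UNIV endo_lrmult) auto
  also have "\<dots> = (\<Sum>b\<in>B. f b (M b))"
  proof (rule sum.cong[OF refl])
    fix b assume b: "b \<in> B"
    have "M b \<in> E" using ZeE C(1) unfolding M_def by blast
    then have "f b (M b) = T (a b * (C b * e))" using a(2)[OF b] by (simp add: M_def)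
    also have "a b * (C b * e) = C b * (a b * e)"
      by (simp only: center_commute[OF C(1), of b "a b", symmetric] flip: mult.assoc)
    also have "\<dots> = C b * a b" by (simp only: E'(5)[OF a(1)[OF b]])
    finally show "trace_on UNIV (\<lambda>s. a b * s * b) = f b (M b)" using C(2) by simp
  qed
  also have "\<dots> = trace_on E M"
    using ZeE C(1) by (intro trace_on_frame[OF E'(1) fr endoM, symmetric]) (auto simp: M_def)
  also have "\<dots> = trace_on ?Ze M"
    using C(1) by (intro trace_on_image Ze E'(1) ZeE endoM) (auto simp: M_def)
  finally have "of_nat N * trace_on UNIV P = trace_on ?Ze (\<lambda>s. \<phi> (of_nat N) * M s)"
    using trace_on_scale[OF Ze endoM, of "of_nat N"] C(1) by (simp add: M_def)
  also have "\<dots> = trace_on ?Ze (\<lambda>s. \<phi> (of_nat (n * q)) * s)"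
  proof (rule trace_on_cong[OF Ze endo_comp[OF endo_lmult endoM] endo_lmult])
    fix x assume x: "x \<in> ?Ze"
    show "\<phi> (of_nat N) * M x \<in> ?Ze"
      using C(1) unfolding M_def by (intro subspace_phi[OF Ze] imageI)
    from x obtain z where z: "z \<in> ring_center" and x: "x = z * e" by blast
    have "\<phi> (of_nat N) * M x = z * (\<phi> (of_nat N) * C e) * e"
      unfolding M_def x CZ[OF z] by (simp only: mult.assoc phi_left_commute[of z])
    also have "\<dots> = \<phi> (of_nat (n * q)) * x"
      unfolding Ce x by (simp only: mult.assoc phi_left_commute[of z])
    finally show "\<phi> (of_nat N) * M x = \<phi> (of_nat (n * q)) * x" .
  qed
  also have "\<dots> = of_nat (n * q) * of_nat (dim ring_center)"
    using trace_on_scale[OF Ze endo_id] trace_on_id[OF Ze] dimZe by simp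
  finally have NP: "of_nat N * trace_on UNIV P = of_nat (n * q) * of_nat (dim ring_center)" .
  \<comment> \<open>The first computation gave \<open>q / n\<close> for the trace of
    \<open>P\<close>, the second \<open>n q p / N\<close> with \<open>p = dim Z\<close>.\<close>
  have "of_nat (N * q) = of_nat N * (of_nat n * trace_on UNIV P)" unfolding trP by simp
  also have "\<dots> = of_nat n * (of_nat N * trace_on UNIV P)" by (simp only: mult.left_commute)
  also have "\<dots> = of_nat ((n\<^sup>2 * dim ring_center) * q)"
    unfolding NP by (simp add: power2_eq_square algebra_simps)
  finally have "N * q = (n\<^sup>2 * dim ring_center) * q" by (simp only: of_nat_eq_iff)
  then have "dim UNIV = n\<^sup>2 * dim ring_center" using q0 by (simp add: N_def del: dim_UNIV)
  then show ?thesis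
    using that[OF e(2), of y g n] yg Te n0 by (simp add: D_def q_def del: dim_UNIV)
qed

theorem ch_trace_multiple_of_reduced:
  assumes "m > 0"
    and t: "functional_on UNIV t" and sym: "\<And>x y. t (x * y) = t (y * x)"
    and t1: "t 1 = of_nat m" and ch: "\<And>x. ch_at t m x"
  shows "\<exists>r. r > 0 \<and> m = r * ring_index \<phi> \<and> (\<forall>x. t x = of_nat r * (T x / of_nat (red_deg \<phi>)))"
proof -
  obtain e y g n where D: "domain_subalgebra {e * s * e |s. True} e" and y: "y \<in> {e * s * e |s. True}"
    and "y \<noteq> 0" and g: "minimal_poly e y g" and Te: "T e = of_nat (n * degree g)"
    and n: "n > 0" "dim UNIV = n\<^sup>2 * dim ring_center"
    by (rule reduced_degree_exists)
  define p where "p = dim ring_center"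
  define q where "q = degree g"
  have q: "q > 0" unfolding q_def by (rule degree_minimal_poly[OF D y g])
  have np: "dim UNIV = n\<^sup>2 * p" using n(2) unfolding p_def .
  have p: "p > 0"
  proof (rule ccontr)
    assume "\<not> p > 0"
    then have "n\<^sup>2 * p = 0" by simp
    then show False using dim_UNIV_pos np by linarith
  qed
  have cd: "center_deg \<phi> = p" unfolding center_deg_def p_def by (rule refl)
  have rd: "red_deg \<phi> = n"
    unfolding red_deg_def cd np
  proof (rule the_equality)
    fix d assume "d\<^sup>2 * p = n\<^sup>2 * p"
    then show "d = n" using p by simp
  qed simp
  \<comment> \<open>The field lemma takes the minimal polynomial of the inverse, so it is applied to
    \<open>x = 1/y\<close>.\<close>
  obtain x where x: "x \<in> {e * s * e |s. True}" "y * x = e" "x * y = e"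
    by (rule domain_subalgebra_inverse[OF D y \<open>y \<noteq> 0\<close>])
  obtain b where b: "t e = of_nat (b * q)"
    using ch_functional_inverse[OF D y g x(1,3,2) t ch] unfolding q_def by blast
  note propor = ch_trace_proportional[OF t sym t1 ch]
  have "of_nat (dim UNIV) * t e = of_nat m * T e" by (rule propor)
  \<comment> \<open>Two values of \<open>t e\<close>, compared as natural numbers; cancelling
    \<open>n q\<close> shows that \<open>b\<close> is the required multiplier.\<close>
  then have "of_nat (n\<^sup>2 * p * (b * q)) = (of_nat (m * (n * q)) :: 'f)"
    unfolding np b Te q_def by simp
  then have "n\<^sup>2 * p * (b * q) = m * (n * q)" by (simp only: of_nat_eq_iff)
  then have "(n * q) * (b * (n * p)) = (n * q) * m" by (simp add: power2_eq_square algebra_simps)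
  then have m: "m = b * (n * p)" using n(1) q by simp
  have "t x = of_nat b * (T x / of_nat n)" for x
  proof -
    have "of_nat (n * n * p) * t x = of_nat (b * (n * p)) * T x"
      using propor[of x] unfolding np m by (simp add: power2_eq_square)
    then have "of_nat (n * p) * (of_nat n * t x) = of_nat (n * p) * (of_nat b * T x)"
      by (simp add: algebra_simps)
    then have "of_nat n * t x = of_nat b * T x" using n(1) p by simp
    then show ?thesis using n(1) by (simp add: field_simps)
  qed
  moreover have "b > 0" using \<open>m > 0\<close> unfolding m by simp
  ultimately show ?thesis using m by (auto simp: ring_index_def rd cd)
qed

end

subsection \<open>Scalar extension\<close>

text \<open>Giving the \<open>k\<close>-th power sum weight \<open>k\<close> makes
  \<open>e_i\<close> homogeneous of weight \<open>i\<close>; this carries the Cayley-Hamilton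
  identity to scalar multiples.\<close>

lemma newton_e_homogeneous:
  fixes ps :: "nat \<Rightarrow> 'f::field_char_0"
  shows "newton_e (\<lambda>k. c ^ k * ps k) i = c ^ i * newton_e ps i"
proof (induction i rule: less_induct)
  case (less i)
  show ?case
  proof (cases i)
    case (Suc i')
    have "(\<Sum>k\<in>{1..Suc i'}. (-1)^(k-1) * newton_e (\<lambda>k. c ^ k * ps k) (Suc i' - k) * (c ^ k * ps k)) =
        (\<Sum>k\<in>{1..Suc i'}. c ^ Suc i' * ((-1)^(k-1) * newton_e ps (Suc i' - k) * ps k))"
    proof (rule sum.cong[OF refl])
      fix k assume k: "k \<in> {1..Suc i'}"
      have "newton_e (\<lambda>k. c ^ k * ps k) (Suc i' - k) = c ^ (Suc i' - k) * newton_e ps (Suc i' - k)"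
        using k Suc by (intro less) auto
      moreover have "c ^ Suc i' = c ^ (Suc i' - k) * c ^ k"
        using k by (simp del: power_Suc flip: power_add)
      ultimately show "(-1)^(k-1) * newton_e (\<lambda>k. c ^ k * ps k) (Suc i' - k) * (c ^ k * ps k) =
          c ^ Suc i' * ((-1)^(k-1) * newton_e ps (Suc i' - k) * ps k)"
        by (simp only: mult_ac)
    qed
    then show ?thesis
      unfolding Suc newton_e.simps(2) by (simp only: sum_distrib_left[symmetric] times_divide_eq_right)
  qed simp
qed

section \<open>Passage from \<open>R\<close> to \<open>S\<close>\<close>

locale scalar_extension_algebra =
  fixes A :: "'r::ring_1 set"
    and j :: "'r \<Rightarrow> 'f::field_char_0"
    and \<phi> :: "'f \<Rightarrow> 'v::ring_1"
    and \<iota> :: "'r \<Rightarrow> 'v"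
    and \<tau> :: "'r \<Rightarrow> 'r"
  assumes subring: "is_subring A"
    and ext: "scalar_extension A j \<phi> \<iota>"
    and trace: "is_trace A \<tau>"
begin

lemma central_algebra: "central_algebra \<phi>"
  using ext unfolding scalar_extension_def central_algebra_def by blast

sublocale central_algebra \<phi> by (rule central_algebra)

lemma A_closed: "0 \<in> A" "1 \<in> A" "x \<in> A \<Longrightarrow> y \<in> A \<Longrightarrow> x + y \<in> A" "x \<in> A \<Longrightarrow> y \<in> A \<Longrightarrow> x * y \<in> A"
  using subring unfolding is_subring_def by blast+

lemma iota_1: "\<iota> 1 = 1" and iota_add: "\<iota> (x + y) = \<iota> x + \<iota> y"
  and iota_mult: "\<iota> (x * y) = \<iota> x * \<iota> y" and inj_iota: "inj \<iota>"
  and phi_j: "a \<in> A \<Longrightarrow> \<phi> (j a) = \<iota> a"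
  using ext unfolding scalar_extension_def by blast+

lemma fraction: "\<exists>a\<in>A. \<exists>b\<in>A. b \<noteq> 0 \<and> x = j a / j b"
  and phi_iota: "\<exists>c r. s = \<phi> c * \<iota> r"
  using ext unfolding scalar_extension_def by blast+

lemma iota_0: "\<iota> 0 = 0"
  using iota_add[of 0 0] by simp

lemma iota_eq_iff: "\<iota> x = \<iota> y \<longleftrightarrow> x = y"
  using inj_iota by (simp add: inj_eq)

lemma iota_sum: "\<iota> (\<Sum>i\<in>I. v i) = (\<Sum>i\<in>I. \<iota> (v i))"
  by (induction I rule: infinite_finite_induct) (auto simp: iota_0 iota_add)

lemma iota_power: "\<iota> (x ^ n) = \<iota> x ^ n"
  by (induction n) (auto simp: iota_1 iota_mult)

lemma phi_eqD: "\<phi> x = \<phi> y \<Longrightarrow> x = y"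
  using phi_eq_0_iff[of "x - y"] by (simp add: phi_diff)

text \<open>The homomorphism laws of \<open>j\<close> on \<open>A\<close> are pulled back from those
  of \<open>\<iota>\<close> along the injective \<open>\<phi>\<close>.\<close>

lemma j_add: "a \<in> A \<Longrightarrow> b \<in> A \<Longrightarrow> j (a + b) = j a + j b"
  by (rule phi_eqD) (simp add: phi_add phi_j A_closed iota_add)

lemma j_mult: "a \<in> A \<Longrightarrow> b \<in> A \<Longrightarrow> j (a * b) = j a * j b"
  by (rule phi_eqD) (simp add: phi_mult phi_j A_closed iota_mult)

lemma j_of_nat: "j (of_nat n) = of_nat n"
proof -
  have "of_nat n \<in> A \<and> \<iota> (of_nat n) = of_nat n"
    by (induction n) (auto simp: A_closed iota_0 iota_add iota_1)
  then show ?thesis by (intro phi_eqD) (simp add: phi_j phi_of_nat)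
qed

lemma j_eq_0: "a \<in> A \<Longrightarrow> j a = 0 \<Longrightarrow> a = 0"
  using phi_j[of a] iota_eq_iff[of a 0] by (simp add: iota_0)

lemma tau_in: "\<tau> x \<in> A" and tau_add: "\<tau> (x + y) = \<tau> x + \<tau> y"
  and tau_scale: "a \<in> A \<Longrightarrow> \<tau> (a * x) = a * \<tau> x" and tau_commute: "\<tau> (x * y) = \<tau> (y * x)"
  using trace unfolding is_trace_def by blast+

lemma prime_scalar_extension:
  assumes "prime_ring TYPE('r)" and ab: "\<And>x. a * x * b = (0 :: 'v)"
  shows "a = 0 \<or> b = 0"
proof -
  obtain c r where a: "a = \<phi> c * \<iota> r" using phi_iota by blast
  obtain c' r' where b: "b = \<phi> c' * \<iota> r'" using phi_iota by blast
  have "c = 0 \<or> c' = 0 \<or> r = 0 \<or> r' = 0"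
  proof (rule ccontr)
    assume *: "\<not> ?thesis"
    have "r * x * r' = 0" for x
    proof -
      have "a * \<iota> x * b = \<phi> c * (\<phi> c' * \<iota> (r * x * r'))"
        by (simp add: a b iota_mult mult.assoc phi_left_commute[of "\<iota> _"])
      then have "\<iota> (r * x * r') = \<iota> 0" using ab[of "\<iota> x"] * by (simp add: iota_0)
      then show ?thesis by (simp only: iota_eq_iff)
    qed
    then show False using assms(1) * unfolding prime_ring_def by blast
  qed
  then show ?thesis by (auto simp: a b iota_0)
qed

lemma finite_spanning_set:
  assumes "fin_gen_module A"
  shows "\<exists>B. finite B \<and> independent B \<and> span B = UNIV"
proof -
  obtain G where G: "finite G" "\<And>r. \<exists>c. (\<forall>g\<in>G. c g \<in> A) \<and> r = (\<Sum>g\<in>G. c g * g)"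
    using assms unfolding fin_gen_module_def by blast
  have sp: "s \<in> span (\<iota> ` G)" for s
  proof -
    obtain c r where s: "s = \<phi> c * \<iota> r" using phi_iota by blast
    obtain d where d: "\<And>g. g \<in> G \<Longrightarrow> d g \<in> A" "r = (\<Sum>g\<in>G. d g * g)" using G(2)[of r] by blast
    have "\<iota> r = (\<Sum>g\<in>G. fscale \<phi> (j (d g)) (\<iota> g))"
      unfolding d(2) iota_sum by (intro sum.cong refl) (simp add: iota_mult fscale_def phi_j d(1))
    moreover have "\<dots> \<in> span (\<iota> ` G)" by (intro span_sum span_scale span_base) auto
    ultimately have "fscale \<phi> c (\<iota> r) \<in> span (\<iota> ` G)" by (metis span_scale)
    then show ?thesis by (simp add: s fscale_def)
  qed
  obtain B where B: "B \<subseteq> \<iota> ` G" "independent B" "\<iota> ` G \<subseteq> span B"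
    by (rule maximal_independent_subset)
  have "span (\<iota> ` G) \<subseteq> span B" using B(3) by (simp add: span_minimal)
  then have "span B = UNIV" using sp by blast
  moreover have "finite B" using B(1) G(1) finite_subset by blast
  ultimately show ?thesis using B(2) by blast
qed

text \<open>A choice is made because \<open>s\<close> has many representations as a scalar times an
  element of \<open>R\<close>.\<close>

definition extended_trace :: "'v \<Rightarrow> 'f" where
  "extended_trace s = (SOME v. \<exists>c r. s = \<phi> c * \<iota> r \<and> v = c * j (\<tau> r))"

text \<open>Clearing denominators turns two representations of one element into an equality
  \<open>a b' r = a' b r'\<close> in \<open>R\<close>, to which \<open>A\<close>-linearity of
  \<open>\<tau>\<close> applies.\<close>

lemma extended_trace_eq: "extended_trace (\<phi> c * \<iota> r) = c * j (\<tau> r)"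
proof -
  have "\<exists>c' r'. \<phi> c * \<iota> r = \<phi> c' * \<iota> r' \<and> extended_trace (\<phi> c * \<iota> r) = c' * j (\<tau> r')"
    unfolding extended_trace_def by (rule someI[of _ "c * j (\<tau> r)"]) blast
  then obtain c' r' where eq: "\<phi> c * \<iota> r = \<phi> c' * \<iota> r'"
    and et: "extended_trace (\<phi> c * \<iota> r) = c' * j (\<tau> r')" by blast
  obtain a b where ab: "a \<in> A" "b \<in> A" "b \<noteq> 0" "c = j a / j b" using fraction by blast
  obtain a' b' where ab': "a' \<in> A" "b' \<in> A" "b' \<noteq> 0" "c' = j a' / j b'" using fraction by blast
  have jb: "j b \<noteq> 0" "j b' \<noteq> 0" using j_eq_0 ab ab' by blast+
  have c: "j b * j b' * c = j (a * b')" "j b * j b' * c' = j (a' * b)"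
    using jb ab ab' by (simp_all add: j_mult)
  have "\<phi> (j b * j b' * c) * \<iota> r = \<phi> (j b * j b' * c') * \<iota> r'"
    using eq by (simp add: phi_mult mult.assoc)
  then have "\<iota> (a * b' * r) = \<iota> (a' * b * r')"
    unfolding c using ab ab' by (simp add: phi_j A_closed iota_mult)
  then have "a * b' * r = a' * b * r'" by (simp only: iota_eq_iff)
  then have "a * b' * \<tau> r = a' * b * \<tau> r'"
    using tau_scale[of "a * b'" r] tau_scale[of "a' * b" r'] ab ab' A_closed(4) by simp
  then have "j (a * b') * j (\<tau> r) = j (a' * b) * j (\<tau> r')"
    using j_mult[of "a * b'" "\<tau> r"] j_mult[of "a' * b" "\<tau> r'"] ab ab' A_closed(4) tau_in by simp
  then have "(j b * j b') * (c * j (\<tau> r)) = (j b * j b') * (c' * j (\<tau> r'))"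
    unfolding c[symmetric] by (simp only: mult.assoc)
  then show ?thesis using jb et by simp
qed

lemma extended_trace_iota: "extended_trace (\<iota> r) = j (\<tau> r)"
  using extended_trace_eq[of 1 r] by simp

lemma functional_extended_trace: "functional_on UNIV extended_trace"
  unfolding functional_on_def
proof (intro conjI ballI allI)
  fix s s'
  obtain c r where s: "s = \<phi> c * \<iota> r" using phi_iota by blast
  obtain c' r' where s': "s' = \<phi> c' * \<iota> r'" using phi_iota by blast
  obtain a b where ab: "a \<in> A" "b \<in> A" "b \<noteq> 0" "c = j a / j b" using fraction by blast
  obtain a' b' where ab': "a' \<in> A" "b' \<in> A" "b' \<noteq> 0" "c' = j a' / j b'" using fraction by blast
  have jb: "j b \<noteq> 0" "j b' \<noteq> 0" using j_eq_0 ab ab' by blast+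
  define d where "d = inverse (j b * j b')"
  have c: "c = d * j (a * b')" "c' = d * j (a' * b)"
    using jb ab ab' by (simp_all add: j_mult d_def field_simps)
  have "s + s' = \<phi> d * \<iota> (a * b' * r + a' * b * r')"
    unfolding s s' c using ab ab' A_closed(4)
    by (simp add: phi_mult phi_j iota_add iota_mult distrib_left mult.assoc)
  then have "extended_trace (s + s') = d * j (\<tau> (a * b' * r + a' * b * r'))"
    by (simp only: extended_trace_eq)
  also have "\<tau> (a * b' * r + a' * b * r') = a * b' * \<tau> r + a' * b * \<tau> r'"
    using tau_scale[of "a * b'" r] tau_scale[of "a' * b" r'] ab ab' A_closed(4) by (simp add: tau_add)
  also have "j \<dots> = j (a * b') * j (\<tau> r) + j (a' * b) * j (\<tau> r')"
    using ab ab' A_closed(4) tau_in j_mult[of "a * b'" "\<tau> r"] j_mult[of "a' * b" "\<tau> r'"]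
    by (simp add: j_add)
  also have "d * \<dots> = extended_trace s + extended_trace s'"
    unfolding s s' extended_trace_eq c by (simp add: distrib_left mult.assoc)
  finally show "extended_trace (s + s') = extended_trace s + extended_trace s'" .
next
  fix d s
  obtain c r where s: "s = \<phi> c * \<iota> r" using phi_iota by blast
  have "\<phi> d * s = \<phi> (d * c) * \<iota> r" by (simp add: s phi_mult mult.assoc)
  then show "extended_trace (\<phi> d * s) = d * extended_trace s"
    by (simp only: s extended_trace_eq mult.assoc)
qed

lemma mult_phi_iota: "\<phi> c * \<iota> r * (\<phi> c' * \<iota> r') = \<phi> (c * c') * \<iota> (r * r')"
  by (simp add: phi_mult iota_mult mult.assoc phi_left_commute[of "\<iota> _"])

lemma extended_trace_commute: "extended_trace (x * y) = extended_trace (y * x)"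
proof -
  obtain c r where x: "x = \<phi> c * \<iota> r" using phi_iota by blast
  obtain c' r' where y: "y = \<phi> c' * \<iota> r'" using phi_iota by blast
  show ?thesis
    unfolding x y mult_phi_iota extended_trace_eq tau_commute[of r r'] by (simp add: mult.commute)
qed

lemma power_phi_iota: "(\<phi> c * \<iota> r) ^ k = \<phi> (c ^ k) * \<iota> (r ^ k)"
  by (induction k) (simp_all add: iota_1 mult_phi_iota)

text \<open>Every \<open>x\<close> is \<open>\<phi> c * \<iota> r\<close>, and each term of the
  identity for \<open>r\<close> scales by the same factor \<open>c ^ m\<close>.\<close>

lemma extended_trace_cayley_hamilton:
  assumes "cayley_hamilton A j \<phi> \<iota> \<tau> m"
  shows "x ^ m + (\<Sum>i\<in>{1..m}. \<phi> ((-1)^i * newton_e (\<lambda>k. extended_trace (x ^ k)) i) * x ^ (m - i)) = 0"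
proof -
  obtain c r where x: "x = \<phi> c * \<iota> r" using phi_iota by blast
  define e where "e = newton_e (\<lambda>k. j (\<tau> (r ^ k)))"
  have ch: "\<iota> r ^ m + (\<Sum>i\<in>{1..m}. \<phi> ((-1)^i * e i) * \<iota> r ^ (m - i)) = 0"
    using assms unfolding cayley_hamilton_def e_def by blast
  have e: "newton_e (\<lambda>k. extended_trace (x ^ k)) i = c ^ i * e i" for i
    unfolding x power_phi_iota extended_trace_eq e_def by (rule newton_e_homogeneous)
  have "\<phi> ((-1)^i * (c ^ i * e i)) * x ^ (m - i) = \<phi> (c ^ m) * (\<phi> ((-1)^i * e i) * \<iota> r ^ (m - i))"
    if "i \<in> {1..m}" for i
  proof -
    have "(-1)^i * (c ^ i * e i) * c ^ (m - i) = c ^ (i + (m - i)) * ((-1)^i * e i)"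
      by (simp only: power_add mult_ac)
    also have "i + (m - i) = m" using that by simp
    finally show ?thesis
      unfolding x power_phi_iota iota_power by (metis mult.assoc phi_mult)
  qed
  then have "x ^ m + (\<Sum>i\<in>{1..m}. \<phi> ((-1)^i * (c ^ i * e i)) * x ^ (m - i)) =
      \<phi> (c ^ m) * \<iota> r ^ m + (\<Sum>i\<in>{1..m}. \<phi> (c ^ m) * (\<phi> ((-1)^i * e i) * \<iota> r ^ (m - i)))"
    by (simp add: x power_phi_iota iota_power)
  also have "\<dots> = \<phi> (c ^ m) * (\<iota> r ^ m + (\<Sum>i\<in>{1..m}. \<phi> ((-1)^i * e i) * \<iota> r ^ (m - i)))"
    by (simp only: distrib_left sum_distrib_left)
  finally show ?thesis unfolding e ch by simp
qed

end

theorem theorem4p2: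
  fixes A :: "'r::ring_1 set"
    and j :: "'r \<Rightarrow> 'f::field_char_0"
    and \<phi> :: "'f \<Rightarrow> 'v::ring_1"
    and \<iota> :: "'r \<Rightarrow> 'v"
    and \<tau> :: "'r \<Rightarrow> 'r"
    and m :: nat
  assumes "prime_ring TYPE('r)"
    and "is_subring A" and "A \<subseteq> ring_center"
    and "scalar_extension A j \<phi> \<iota>"
    and "integrally_closed A j"
    and "fin_gen_module A"
    and "is_trace A \<tau>"
    and "cayley_hamilton A j \<phi> \<iota> \<tau> m"
  shows "\<exists>r::nat. r > 0 \<and> m = r * ring_index \<phi> \<and>
           (\<forall>x. j (\<tau> x) = of_nat r * reduced_trace \<phi> \<iota> x)"
proof -
  interpret scalar_extension_algebra A j \<phi> \<iota> \<tau>
    using assms by unfold_locales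
  obtain B where B: "finite B" "independent B" "span B = UNIV"
    using finite_spanning_set[OF assms(6)] by blast
  interpret prime_fd_algebra \<phi> B
  proof unfold_locales
    show "a = 0 \<or> b = 0" if "\<And>x. a * x * b = 0" for a b :: 'v
      using assms(1) that by (rule prime_scalar_extension)
  qed (use B in auto)
  \<comment> \<open>For \<open>m = 0\<close> the Cayley-Hamilton identity would read
    \<open>1 = 0\<close>.\<close>
  have "m > 0"
  proof (rule ccontr)
    assume "\<not> m > 0"
    then show False using assms(8) unfolding cayley_hamilton_def by simp
  qed
  moreover have "extended_trace 1 = of_nat m"
    using extended_trace_iota[of 1] assms(8) unfolding cayley_hamilton_def
    by (simp add: iota_1 j_of_nat)
  ultimately obtain r where r: "r > 0" "m = r * ring_index \<phi>"
    "\<And>s. extended_trace s = of_nat r * (T s / of_nat (red_deg \<phi>))"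
    using ch_trace_multiple_of_reduced[OF _ functional_extended_trace extended_trace_commute, of m]
      extended_trace_cayley_hamilton[OF assms(8)] unfolding ch_at_def by blast
  have "j (\<tau> x) = of_nat r * reduced_trace \<phi> \<iota> x" for x
    using r(3)[of "\<iota> x"]
    by (simp add: extended_trace_iota reduced_trace_def lin_trace_eq[OF endo_lmult] T_def)
  then show ?thesis using r(1,2) by blast
qed

end
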